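(* Let $\mathscr{A}=\{A,B,C,D\}$ and give $\mathscr{A}^{\mathbb{Z}}$ the product topology (with $\mathscr{A}$ discrete). The closure in $\mathscr{A}^{\mathbb{Z}}$ of the set of cutting sequences of bi-infinite linear trajectories in the regular octagon coincides with the set of infinitely coherent words.
   Context: **Octagon and cutting sequences.** Let $O\subset\mathbb{R}^2$ be the regular octagon centred at the origin with unit sides, two of them horizontal, and vertices $O_1,\dots,O_8$ in clockwise order, $\overline{O_1O_2}$ being the top horizontal side. Opposite (parallel) sides are identified by translation, and the pairs of identified sides are labelled: $\overline{O_1O_2},\overline{O_5O_6}$ by $A$; $\overline{O_2O_3},\overline{O_6O_7}$ by $B$; $\overline{O_3O_4},\overline{O_7O_8}$ by $C$; $\overline{O_4O_5},\overline{O_8O_1}$ by $D$. A (bi-infinite) linear trajectory in direction $\theta$ moves with constant velocity making angle $\theta$ with the horizontal; when it hits a side it re-enters $O$ at the corresponding point of the opposite side with the same velocity; it never hits a vertex and is defined for all times in $\mathbb{R}$. Its cutting sequence $c(\tau)\in\mathscr{A}^{\mathbb{Z}}$ is the bi-infinite word of labels of the sides it crosses, in order (the choice of the origin of the indexing is irrelevant: bi-infinite words are considered up to shift). **Permutations and diagrams.** Let $\pi_0=\mathrm{Id}$, $\pi_1=(AD)(BC)$, $\pi_2=(ABCD)$, $\pi_3=(AC)$, $\pi_4=(AC)(BD)$, $\pi_5=(AB)(CD)$, $\pi_6=(ADCB)$, $\pi_7=(BD)$ (cycle notation: $(ABCD)$ sends $A\mapsto B\mapsto C\mapsto D\mapsto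 A$). A permutation $\pi$ acts on words letter by letter, written $\pi\cdot w$. A word is admissible in diagram $0$ if every pair of consecutive letters belongs to $\{AD,DA,DB,BD,BC,CB,CC\}$; it is admissible in diagram $i$ ($0\le i\le 7$) if $\pi_i\cdot w$ is admissible in diagram $0$. It is admissible if it is admissible in some diagram. **Derivation.** A letter occurrence in $w\in\mathscr{A}^{\mathbb{Z}}$ is sandwiched if the letters immediately before and after it are equal; it is $L'$-sandwiched if both are equal to $L'$. The derived sequence $w'$ is obtained from $w$ by keeping only the sandwiched letters. $w$ is derivable if $w$ and $w'$ are admissible, and infinitely derivable if $w$ and all its iterated derived sequences are derivable. **Coherence.** A derivable word $w$ is coherent with respect to $(i,j)$, $i,j\in\{0,\dots,7\}$, if: (C0) $w$ is admissible in diagram $i$; and, putting $n(w):=\pi_i\cdot w$: (C1) there is $k\in\{0,1,2,3\}$ such that all sandwiched letters occurring in $n(w)$ belong to the group $G_k$, where $G_0=\{D$-sandwiched $A$, $C$-sandwiched $B$, $B$-sandwiched $C$, $A$-sandwiched $D\}$, $G_1=\{D$-sandwiched $A$, $C$-sandwiched $B$, $B$-sandwiched $C$, $B$-sandwiched $D\}$, $G_2=\{D$-sandwiched $A$, $C$-sandwiched $B$, $C$-sandwiched $C$, $B$-sandwiched $D\}$, $G_3=\{D$-sandwiched $A$, $D$-sandwiched $B$, $C$-sandwiched $C$, $B$-sandwiched $D\}$; (C2) $n(w)'$ is admissible in diagram $j$ and $j\in\{1,\dots,7\}$; (C3) $k=[j/2]$ (integer part). **Infinite coherence.** Let $S^*$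 be the set of sequences $s=\{s_k\}_{k\in\mathbb{N}}$ ($\mathbb N\ni 0$) with $s_0\in\{0,\dots,7\}$ and $s_k\in\{1,\dots,7\}$ for $k\ge1$. Given $w$ and $s\in S^*$, put $w_0:=w$, $w_k:=(\pi_{s_{k-1}}\cdot w_{k-1})'$ for $k\ge1$. The word $w$ is infinitely coherent with respect to $s$ if it is infinitely derivable and for each $k\in\mathbb{N}$ the word $w_k$ is coherent with respect to $(s_k,s_{k+1})$. It is infinitely coherent if it is so with respect to some $s\in S^*$. *)

theory Defs
  imports "HOL-Analysis.Analysis" "HOL-Combinatorics.Combinatorics"
begin

datatype letter = A | B | C | D

type_synonym bi_word = "int \<Rightarrow> letter"


text \<open>
  The plane is identified with the complex numbers. A regular octagon with unit sides has
  circumradius \<open>1 / (2 * sin (pi / 8))\<close>; \<open>vertex 1\<close> and \<open>vertex 2\<close> are the left and right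
  endpoints of the top horizontal side, and \<open>vertex\<close> is periodic with period 8.
\<close>

definition vertex :: "nat \<Rightarrow> complex" where
  "vertex k = (1 / (2 * sin (pi / 8))) *\<^sub>R cis (5 * pi / 8 - (real k - 1) * pi / 4)"

definition octagon :: "complex set" where
  "octagon = convex hull (vertex ` {1..8})"

definition open_side :: "nat \<Rightarrow> complex set" where
  "open_side k = open_segment (vertex k) (vertex (k + 1))"

text \<open>
  The translation taking side \<open>k\<close> to the opposite side \<open>k + 4\<close> sends \<open>vertex k\<close> to
  \<open>vertex (k + 5)\<close>, and \<open>vertex (k + 1)\<close> to \<open>vertex (k + 4)\<close>.
\<close>

definition side_translation :: "nat \<Rightarrow> complex" where
  "side_translation k = vertex (k + 5) - vertex k"

definition side_label :: "nat \<Rightarrow> letter" where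
  "side_label k = [D, A, B, C] ! (k mod 4)"

text \<open>
  \<open>T n\<close> are the successive times at which the trajectory \<open>\<tau>\<close> hits a side, and \<open>\<sigma> n\<close> is the side
  it exits through at time \<open>T n\<close>. At a hitting time, \<open>\<tau>\<close> takes the value of the re-entry point.
  Hitting points lie on open sides, so no vertex is ever hit; the hitting times exhaust the
  whole time axis.
\<close>

definition octagon_trajectory ::
  "real \<Rightarrow> (real \<Rightarrow> complex) \<Rightarrow> (int \<Rightarrow> real) \<Rightarrow> (int \<Rightarrow> nat) \<Rightarrow> bool" where
  "octagon_trajectory \<theta> \<tau> T \<sigma> \<longleftrightarrow>
     strict_mono T \<and> (\<forall>t. \<exists>n. T n \<le> t \<and> t < T (n + 1)) \<and> (\<forall>n. \<sigma> n \<in> {1..8}) \<and>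
     (\<exists>c>0. \<forall>n.
        (\<forall>t\<in>{T n<..<T (n + 1)}.
           \<tau> t = \<tau> (T n) + (c * (t - T n)) *\<^sub>R cis \<theta> \<and> \<tau> t \<in> interior octagon) \<and>
        (\<exists>p\<in>open_side (\<sigma> (n + 1)).
           p = \<tau> (T n) + (c * (T (n + 1) - T n)) *\<^sub>R cis \<theta> \<and>
           \<tau> (T (n + 1)) = p + side_translation (\<sigma> (n + 1))))"

text \<open>All indexings of each cutting sequence are included, as \<open>T\<close> and \<open>\<sigma>\<close> may be reindexed.\<close>

definition cutting_sequences :: "bi_word set" where
  "cutting_sequences = {side_label \<circ> \<sigma> | \<theta> \<tau> T \<sigma>. octagon_trajectory \<theta> \<tau> T \<sigma>}"


definition diagram_perm :: "nat \<Rightarrow> letter \<Rightarrow> letter" where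
  "diagram_perm i =
     [id,
      cycle_of_list [A, D] \<circ> cycle_of_list [B, C],
      cycle_of_list [A, B, C, D],
      cycle_of_list [A, C],
      cycle_of_list [A, C] \<circ> cycle_of_list [B, D],
      cycle_of_list [A, B] \<circ> cycle_of_list [C, D],
      cycle_of_list [A, D, C, B],
      cycle_of_list [B, D]] ! i"

definition admissible_0 :: "bi_word \<Rightarrow> bool" where
  "admissible_0 w \<longleftrightarrow>
     (\<forall>n. (w n, w (n + 1)) \<in> {(A, D), (D, A), (D, B), (B, D), (B, C), (C, B), (C, C)})"

definition admissible_in :: "nat \<Rightarrow> bi_word \<Rightarrow> bool" where
  "admissible_in i w \<longleftrightarrow> i \<in> {0..7} \<and> admissible_0 (diagram_perm i \<circ> w)"

definition admissible :: "bi_word \<Rightarrow> bool" where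
  "admissible w \<longleftrightarrow> (\<exists>i. admissible_in i w)"

definition sandwiched_by :: "letter \<Rightarrow> bi_word \<Rightarrow> int \<Rightarrow> bool" where
  "sandwiched_by L w n \<longleftrightarrow> w (n - 1) = L \<and> w (n + 1) = L"

definition sandwiched :: "bi_word \<Rightarrow> int \<Rightarrow> bool" where
  "sandwiched w n \<longleftrightarrow> w (n - 1) = w (n + 1)"

text \<open>
  An increasing enumeration of the sandwiched positions is unique up to a shift of the index,
  and everything below is invariant under shifts. It exists for every admissible word (lemma
  \<open>admissible_enumeration\<close>), and \<open>derived\<close> only matters for such words.
\<close>

definition derived :: "bi_word \<Rightarrow> bi_word" where
  "derived w = w \<circ> (SOME f :: int \<Rightarrow> int. strict_mono f \<and> range f = {n. sandwiched w n})"

lemma int_set_enumeration: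
  fixes S :: "int set"
  assumes up: "\<And>n. \<exists>m\<in>S. n < m" and dn: "\<And>n. \<exists>m\<in>S. m < n"
  shows "\<exists>f :: int \<Rightarrow> int. strict_mono f \<and> range f = S"
proof -
  define nx where "nx x = x + 1 + int (LEAST k. x + 1 + int k \<in> S)" for x
  define pv where "pv x = x - 1 - int (LEAST k. x - 1 - int k \<in> S)" for x
  have nx_S: "nx x \<in> S" for x
  proof -
    obtain m where "m \<in> S" "x < m" using up by blast
    then have "x + 1 + int (nat (m - x - 1)) \<in> S" by simp
    then show ?thesis unfolding nx_def by (rule LeastI)
  qed
  have pv_S: "pv x \<in> S" for x
  proof -
    obtain m where "m \<in> S" "m < x" using dn by blast
    then have "x - 1 - int (nat (x - m - 1)) \<in> S" by simp
    then show ?thesis unfolding pv_def by (rule LeastI)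
  qed
  have nx_gt: "x < nx x" and pv_lt: "pv x < x" for x unfolding nx_def pv_def by simp_all
  have nx_le: "nx x \<le> y" if "y \<in> S" "x < y" for x y
  proof -
    have "x + 1 + int (nat (y - x - 1)) \<in> S" using that by simp
    then have "(LEAST k. x + 1 + int k \<in> S) \<le> nat (y - x - 1)" by (rule Least_le)
    then show ?thesis unfolding nx_def using that by linarith
  qed
  have pv_ge: "y \<le> pv x" if "y \<in> S" "y < x" for x y
  proof -
    have "x - 1 - int (nat (x - y - 1)) \<in> S" using that by simp
    then have "(LEAST k. x - 1 - int k \<in> S) \<le> nat (x - y - 1)" by (rule Least_le)
    then show ?thesis unfolding pv_def using that by linarith
  qed
  have nx_pv: "nx (pv x) = x" if "x \<in> S" for x
    using nx_le[OF that pv_lt] nx_gt[of "pv x"] pv_ge[OF nx_S, of "pv x" x] by linarith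
  have pv_nx: "pv (nx x) = x" if "x \<in> S" for x
    using pv_ge[OF that nx_gt] pv_lt[of "nx x"] nx_le[OF pv_S, of x "nx x"] by linarith
  obtain x0 where x0: "x0 \<in> S" using up by blast
  define f where "f n = (if n \<ge> 0 then (nx ^^ nat n) x0 else (pv ^^ nat (- n)) x0)" for n :: int
  have pvS: "(pv ^^ k) x0 \<in> S" and nxS: "(nx ^^ k) x0 \<in> S" for k
    by (induction k) (use x0 nx_S pv_S in auto)
  then have f_S: "f n \<in> S" for n unfolding f_def by simp
  have f_Suc: "f (n + 1) = nx (f n)" for n
  proof (cases "n \<ge> 0")
    case True
    then have "nat (n + 1) = Suc (nat n)" by simp
    with True show ?thesis unfolding f_def by simp
  next
    case False
    then have "nat (- n) = Suc (nat (- (n + 1)))" by simp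
    with False show ?thesis unfolding f_def using nx_pv[OF pvS] by auto
  qed
  have f_pred: "f (n - 1) = pv (f n)" for n
    using f_Suc[of "n - 1"] pv_nx[OF f_S, of "n - 1"] by simp
  have step: "f n < f (n + int (Suc k))" for n k
  proof (induction k)
    case 0
    show ?case using f_Suc[of n] nx_gt by simp
  next
    case (Suc k)
    have "f (n + int (Suc (Suc k))) = nx (f (n + int (Suc k)))"
      using f_Suc[of "n + int (Suc k)"] by (simp add: algebra_simps)
    with Suc nx_gt show ?case by (metis order.strict_trans)
  qed
  have "strict_mono f"
  proof (rule strict_monoI)
    fix a b :: int assume "a < b"
    then show "f a < f b" using step[of a "nat (b - a - 1)"] by simp
  qed
  moreover have "y \<in> range f" if "y \<in> S" for y
    using that
  proof (induction "nat \<bar>y - x0\<bar>" arbitrary: y rule: less_induct)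
    case less
    consider "y = x0" | "x0 < y" | "y < x0" by linarith
    then show ?case
    proof cases
      case 1
      then have "y = f 0" unfolding f_def by simp
      then show ?thesis by simp
    next
      case 2
      have "nat \<bar>pv y - x0\<bar> < nat \<bar>y - x0\<bar>" using pv_ge[OF x0 2] pv_lt[of y] 2 by linarith
      then obtain n where "pv y = f n" using less.hyps pv_S by blast
      then have "y = f (n + 1)" using f_Suc nx_pv[OF less.prems] by simp
      then show ?thesis by simp
    next
      case 3
      have "nat \<bar>nx y - x0\<bar> < nat \<bar>y - x0\<bar>" using nx_le[OF x0 3] nx_gt[of y] 3 by linarith
      then obtain n where "nx y = f n" using less.hyps nx_S by blast
      then have "y = f (n - 1)" using f_pred pv_nx[OF less.prems] by simp
      then show ?thesis by simp
    qed
  qed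
  ultimately show ?thesis using f_S by blast
qed

lemma inj_diagram_perm:
  assumes "i \<in> {0..7}"
  shows "inj (diagram_perm i)"
proof -
  have "i \<in> {0, 1, 2, 3, 4, 5, 6, 7}" using assms by auto
  then show ?thesis
    unfolding diagram_perm_def
    by (auto intro!: inj_compose inj_on_id)
qed

lemma admissible_0_sandwiched:
  assumes "admissible_0 w"
  shows "\<exists>m\<in>{n + 1..n + 9}. sandwiched w m"
proof (rule ccontr)
  assume "\<not> ?thesis"
  then have ns: "w (m - 1) \<noteq> w (m + 1)" if "n + 1 \<le> m" "m \<le> n + 9" for m
    using that unfolding sandwiched_def by auto
  have ad: "(w m, w (m + 1)) \<in> {(A, D), (D, A), (D, B), (B, D), (B, C), (C, B), (C, C)}" for m
    using assms unfolding admissible_0_def by blast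
  define a where "a k = w (n + int k)" for k
  have A: "(a k, a (Suc k)) \<in> {(A, D), (D, A), (D, B), (B, D), (B, C), (C, B), (C, C)}" for k
    using ad[of "n + int k"] unfolding a_def by (simp add: algebra_simps)
  have N: "a k \<noteq> a (Suc (Suc k))" if "k \<le> 8" for k
    using ns[of "n + int k + 1"] that unfolding a_def by (simp add: algebra_simps)
  have step: "(a (Suc k), a (Suc (Suc k))) =
      (case (a k, a (Suc k)) of (A, D) \<Rightarrow> (D, B) | (D, B) \<Rightarrow> (B, C) | (B, C) \<Rightarrow> (C, C)
        | (C, C) \<Rightarrow> (C, B) | (C, B) \<Rightarrow> (B, D) | (B, D) \<Rightarrow> (D, A) | _ \<Rightarrow> (a 0, a 0))"
    and turn: "(a k, a (Suc k)) \<noteq> (D, A)" if "k \<le> 8" for k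
    using A[of k] A[of "Suc k"] N[OF that] by auto
  have "(a 0, a 1) \<in> {(A, D), (D, B), (B, C), (C, C), (C, B), (B, D)}"
    using A[of 0] turn[of 0] by auto
  then show False
    using step[of 0] step[of 1] step[of 2] step[of 3] step[of 4] step[of 5] step[of 6]
      turn[of 0] turn[of 1] turn[of 2] turn[of 3] turn[of 4] turn[of 5] turn[of 6] turn[of 7]
    by (simp add: numeral_eq_Suc) (elim disjE conjE; simp)
qed

lemma admissible_enumeration:
  assumes "admissible w"
  shows "\<exists>f :: int \<Rightarrow> int. strict_mono f \<and> range f = {n. sandwiched w n}"
proof -
  obtain i where i: "i \<in> {0..7}" "admissible_0 (diagram_perm i \<circ> w)"
    using assms unfolding admissible_def admissible_in_def by blast
  have eq: "sandwiched (diagram_perm i \<circ> w) m = sandwiched w m" for m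
    using inj_diagram_perm[OF i(1)] unfolding sandwiched_def by (simp add: inj_eq)
  have ex: "\<exists>m\<in>{n + 1..n + 9}. sandwiched w m" for n
    using admissible_0_sandwiched[OF i(2)] eq by auto
  show ?thesis
  proof (rule int_set_enumeration)
    show "\<exists>m\<in>{n. sandwiched w n}. n < m" for n using ex[of n] by force
    show "\<exists>m\<in>{n. sandwiched w n}. m < n" for n using ex[of "n - 10"] by force
  qed
qed

definition derivable :: "bi_word \<Rightarrow> bool" where
  "derivable w \<longleftrightarrow> admissible w \<and> admissible (derived w)"

definition infinitely_derivable :: "bi_word \<Rightarrow> bool" where
  "infinitely_derivable w \<longleftrightarrow> (\<forall>k. derivable ((derived ^^ k) w))"


text \<open>The pair \<open>(L', L)\<close> stands for an \<open>L'\<close>-sandwiched \<open>L\<close>.\<close>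

definition sandwich_group :: "nat \<Rightarrow> (letter \<times> letter) set" where
  "sandwich_group k =
     [{(D, A), (C, B), (B, C), (A, D)},
      {(D, A), (C, B), (B, C), (B, D)},
      {(D, A), (C, B), (C, C), (B, D)},
      {(D, A), (D, B), (C, C), (B, D)}] ! k"

definition coherent :: "nat \<Rightarrow> nat \<Rightarrow> bi_word \<Rightarrow> bool" where
  "coherent i j w \<longleftrightarrow>
     derivable w \<and> admissible_in i w \<and>
     (let v = diagram_perm i \<circ> w in
        \<exists>k\<in>{0..3}.
          (\<forall>n L. sandwiched_by L v n \<longrightarrow> (L, v n) \<in> sandwich_group k) \<and>
          admissible_in j (derived v) \<and> j \<in> {1..7} \<and>
          k = j div 2)"

definition S_star :: "(nat \<Rightarrow> nat) set" where
  "S_star = {s. s 0 \<in> {0..7} \<and> (\<forall>k\<ge>1. s k \<in> {1..7})}"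

primrec renormalized :: "(nat \<Rightarrow> nat) \<Rightarrow> bi_word \<Rightarrow> nat \<Rightarrow> bi_word" where
  "renormalized s w 0 = w"
| "renormalized s w (Suc k) = derived (diagram_perm (s k) \<circ> renormalized s w k)"

definition infinitely_coherent_wrt :: "(nat \<Rightarrow> nat) \<Rightarrow> bi_word \<Rightarrow> bool" where
  "infinitely_coherent_wrt s w \<longleftrightarrow>
     infinitely_derivable w \<and> (\<forall>k. coherent (s k) (s (Suc k)) (renormalized s w k))"

definition infinitely_coherent :: "bi_word \<Rightarrow> bool" where
  "infinitely_coherent w \<longleftrightarrow> (\<exists>s\<in>S_star. infinitely_coherent_wrt s w)"

end

theory Submission imports Defs begin

text \<open>
  Projecting a trajectory along its direction turns it into an orbit of an interval exchange.
  Up to the eight symmetries of the octagon modulo the central one, which act on labels through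
  the permutations of the diagrams, the direction lies in the sector \<open>[0, pi / 8]\<close>; there the sides
  \<open>A\<close>, \<open>B\<close>, \<open>C\<close>, \<open>D\<close> project to intervals that are put back in the opposite order.

  The crucial step is the renormalization by an affine automorphism of the octagon surface. It
  splits the sector into seven subsectors \<open>j = 1, ..., 7\<close>. For a direction in subsector \<open>j\<close> the
  sandwiched letters are exactly those of the group \<open>j div 2\<close>, the points of the orbit with a given
  sandwiched letter fill an interval, and an isometry on each of these intervals maps the sandwiched
  part of the orbit to an orbit of an interval exchange of the same family, coded by the derived
  word permuted by the diagram \<open>j\<close>. The construction can be reversed, because the letters
  between two consecutive sandwiched ones are forced.

  Hence the codes of the first sector are a finite union of sets of coherent words; this passes to
  closures, and iterating it shows that words in the closure are infinitely coherent. Conversely,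
  a window of an infinitely coherent word is covered by the block generated from a window of the
  derived word, which is strictly shorter unless the given window is an alternating word
  \<open>xyxy...\<close>. So every window is obtained by finitely many generation steps from an alternating
  word, which is realized in a cylinder, and a window of an orbit extends to a bi-infinite orbit
  after a generic small translation.
\<close>

section \<open>Finite windows and the topological closure\<close>

text \<open>The words agreeing with \<open>w\<close> on \<open>{-N..N}\<close> form a neighbourhood
  basis of \<open>w\<close> in the product topology, so this is the topological closure in
  combinatorial form.\<close>

definition window_closure :: "bi_word set \<Rightarrow> bi_word set" where
  "window_closure S = {w. \<forall>N. \<exists>u\<in>S. \<forall>n. \<bar>n\<bar> \<le> N \<longrightarrow> u n = w n}"

lemma window_closureI: "(\<And>N. \<exists>u\<in>S. \<forall>n. \<bar>n\<bar> \<le> N \<longrightarrow> u n = w n) \<Longrightarrow> w \<in> window_closure S"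
  by (simp add: window_closure_def)

lemma window_closureE:
  assumes "w \<in> window_closure S"
  obtains u where "u \<in> S" "\<And>n. \<bar>n\<bar> \<le> N \<Longrightarrow> u n = w n"
  using assms by (auto simp: window_closure_def)

lemma closure_of_words:
  "product_topology (\<lambda>_. discrete_topology UNIV) UNIV closure_of S = window_closure S"
proof (intro set_eqI iffI)
  fix w :: bi_word
  assume w: "w \<in> product_topology (\<lambda>_. discrete_topology UNIV) UNIV closure_of S"
  have "\<exists>u\<in>S. \<forall>n. \<bar>n\<bar> \<le> N \<longrightarrow> u n = w n" for N
  proof -
    define U where "U n = (if \<bar>n\<bar> \<le> N then {w n} else UNIV)" for n
    have "finite {n. U n \<noteq> UNIV}"
      by (rule finite_subset[of _ "{-N..N}"]) (auto simp: U_def split: if_splits)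
    then have "openin (product_topology (\<lambda>_::int. discrete_topology (UNIV::letter set)) UNIV)
        (Pi\<^sub>E UNIV U)"
      by (intro product_topology_basis) auto
    moreover have "w \<in> Pi\<^sub>E UNIV U" by (auto simp: U_def)
    ultimately obtain u where "u \<in> S" "u \<in> Pi\<^sub>E UNIV U" using w unfolding in_closure_of by blast
    then show ?thesis by (intro bexI[of _ u]) (auto simp: U_def PiE_iff split: if_splits)
  qed
  then show "w \<in> window_closure S" by (rule window_closureI)
next
  fix w :: bi_word
  assume w: "w \<in> window_closure S"
  have "\<exists>y. y \<in> S \<and> y \<in> T"
    if T: "w \<in> T" "openin (product_topology (\<lambda>_::int. discrete_topology (UNIV::letter set)) UNIV)
        T" for T
  proof -
    obtain U where U: "finite {i. U i \<noteq> UNIV}" "w \<in> Pi\<^sub>E UNIV U" "Pi\<^sub>E UNIV U \<subseteq> T"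
      using T unfolding openin_product_topology_alt by auto
    obtain N where N: "\<And>i. U i \<noteq> UNIV \<Longrightarrow> \<bar>i\<bar> \<le> N"
      using finite_nat_set_iff_bounded_le[of "(\<lambda>i. nat \<bar>i\<bar>) ` {i. U i \<noteq> UNIV}"] U(1)
      by (metis (mono_tags, lifting) finite_imageI image_eqI mem_Collect_eq nat_le_iff)
    obtain u where "u \<in> S" "\<And>n. \<bar>n\<bar> \<le> N \<Longrightarrow> u n = w n" using window_closureE[OF w, where N = N]
        by blast
    moreover have "u \<in> Pi\<^sub>E UNIV U" using U(2) N \<open>\<And>n. \<bar>n\<bar> \<le> N \<Longrightarrow> u n = w n\<close>
      by (auto simp: PiE_iff) (metis UNIV_I)
    ultimately show ?thesis using U(3) by blast
  qed
  then show "w \<in> product_topology (\<lambda>_. discrete_topology UNIV) UNIV closure_of S"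
    unfolding in_closure_of by auto
qed

lemma window_closure_mono:
  assumes "S \<subseteq> S'"
  shows "window_closure S \<subseteq> window_closure S'"
proof (intro subsetI window_closureI)
  fix w N assume "w \<in> window_closure S"
  then obtain u where "u \<in> S" "\<And>n. \<bar>n\<bar> \<le> N \<Longrightarrow> u n = w n" by (rule window_closureE[where N = N]) blast
  then show "\<exists>u\<in>S'. \<forall>n. \<bar>n\<bar> \<le> N \<longrightarrow> u n = w n" using assms by blast
qed

text \<open>The windows separating a word from each of finitely many sets have a common bound, and
  the window of that size separates it from the union.\<close>

lemma window_closure_UN:
  assumes "finite I"
  shows "window_closure (\<Union>i\<in>I. S i) = (\<Union>i\<in>I. window_closure (S i))"
proof
  show "window_closure (\<Union>i\<in>I. S i) \<subseteq> (\<Union>i\<in>I. window_closure (S i))"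
  proof (rule subsetI, rule ccontr)
    fix w assume w: "w \<in> window_closure (\<Union>i\<in>I. S i)" "w \<notin> (\<Union>i\<in>I. window_closure (S i))"
    then have "\<forall>i\<in>I. \<exists>N. \<forall>u\<in>S i. \<exists>n. \<bar>n\<bar> \<le> N \<and> u n \<noteq> w n" by (auto simp: window_closure_def)
    then obtain N where N: "\<And>i. i \<in> I \<Longrightarrow> \<forall>u\<in>S i. \<exists>n. \<bar>n\<bar> \<le> N i \<and> u n \<noteq> w n"
      unfolding bchoice_iff by auto
    define M where "M = Max (insert 0 (N ` I))"
    have M: "N i \<le> M" if "i \<in> I" for i using that assms unfolding M_def by simp
    obtain u where u: "u \<in> (\<Union>i\<in>I. S i)" "\<And>n. \<bar>n\<bar> \<le> M \<Longrightarrow> u n = w n"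
      using window_closureE[OF w(1), where N = M] by blast
    then obtain i where i: "i \<in> I" "u \<in> S i" by blast
    then obtain n where "\<bar>n\<bar> \<le> N i" "u n \<noteq> w n" using N by blast
    with u(2)[of n] M[OF i(1)] show False by simp
  qed
  show "(\<Union>i\<in>I. window_closure (S i)) \<subseteq> window_closure (\<Union>i\<in>I. S i)"
    by (intro UN_least window_closure_mono) blast
qed

text \<open>A bijection of the alphabet acts as a homeomorphism; approximating words are pulled back
  by its inverse.\<close>

lemma window_closure_recode:
  assumes "bij \<pi>"
  shows "window_closure {w. \<pi> \<circ> w \<in> S} = {w. \<pi> \<circ> w \<in> window_closure S}"
proof (intro set_eqI iffI)
  fix w assume w: "w \<in> window_closure {w. \<pi> \<circ> w \<in> S}"
  have "\<exists>u\<in>S. \<forall>n. \<bar>n\<bar> \<le> N \<longrightarrow> u n = (\<pi> \<circ> w) n" for N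
  proof -
    obtain u where "u \<in> {w. \<pi> \<circ> w \<in> S}" "\<And>n. \<bar>n\<bar> \<le> N \<Longrightarrow> u n = w n"
      using window_closureE[OF w, where N = N] by blast
    then show ?thesis by (intro bexI[of _ "\<pi> \<circ> u"]) auto
  qed
  then show "w \<in> {w. \<pi> \<circ> w \<in> window_closure S}" using window_closureI by blast
next
  fix w assume w: "w \<in> {w. \<pi> \<circ> w \<in> window_closure S}"
  have "\<exists>u. \<pi> \<circ> u \<in> S \<and> (\<forall>n. \<bar>n\<bar> \<le> N \<longrightarrow> u n = w n)" for N
  proof -
    from w have "\<pi> \<circ> w \<in> window_closure S" by simp
    then obtain v where v: "v \<in> S" "\<And>n. \<bar>n\<bar> \<le> N \<Longrightarrow> v n = (\<pi> \<circ> w) n" using window_closureE by metis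
    have "\<pi> \<circ> (inv \<pi> \<circ> v) = v" using assms by (simp add: fun_eq_iff bij_is_surj surj_f_inv_f)
    then show ?thesis using v assms
      by (intro exI[of _ "inv \<pi> \<circ> v"]) (simp add: bij_is_inj)
  qed
  then show "w \<in> window_closure {w. \<pi> \<circ> w \<in> S}" by (intro window_closureI) simp
qed

section \<open>Derivation and its compatibility with closures\<close>

lemma derived_enumeration:
  assumes "admissible w"
  obtains f where "strict_mono f" "range f = {n. sandwiched w n}" "derived w = w \<circ> f"
  using someI_ex[OF admissible_enumeration[OF assms]] that unfolding derived_def by blast

lemma sandwiched_comp: "inj \<pi> \<Longrightarrow> sandwiched (\<pi> \<circ> w) = sandwiched w"
  by (auto simp: sandwiched_def fun_eq_iff inj_eq)

lemma derived_comp: "inj \<pi> \<Longrightarrow> derived (\<pi> \<circ> w) = \<pi> \<circ> derived w"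
  by (simp add: derived_def sandwiched_comp comp_assoc)

text \<open>\<open>derived\<close> uses an arbitrary enumeration, so words that agree on a window
  have matching derived words only up to an index shift. Both enumerations pass through the same
  points in the same order, and the shift is read off at the left end.\<close>

lemma enumerations_agree:
  fixes f g :: "int \<Rightarrow> int"
  assumes f: "strict_mono f" and g: "strict_mono g"
    and ran: "\<And>m. f a \<le> m \<Longrightarrow> m \<le> f b \<Longrightarrow> m \<in> range f \<longleftrightarrow> m \<in> range g" and ab: "a \<le> b"
  shows "\<exists>s. \<forall>i\<in>{a..b}. g (i + s) = f i"
proof -
  have fle: "f x \<le> f y \<longleftrightarrow> x \<le> y" "f x < f y \<longleftrightarrow> x < y" "g x < g y \<longleftrightarrow> x < y" for x y
    using f g by (simp_all add: strict_mono_less strict_mono_less_eq)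
  have "f a \<in> range g" using ran[of "f a"] ab fle by simp
  then obtain c where c: "g c = f a" by auto
  define s where "s = c - a"
  have "i \<le> b \<longrightarrow> g (i + s) = f i" if "a \<le> i" for i
    using that
  proof (induction i rule: int_ge_induct)
    case base
    show ?case by (simp add: s_def c)
  next
    case (step i)
    show ?case
    proof
      assume b: "i + 1 \<le> b"
      then have IH: "g (i + s) = f i" using step by simp
      have "f (i + 1) \<in> range g" using ran[of "f (i + 1)"] fle step b by simp
      then obtain d where d: "g d = f (i + 1)" by auto
      have "g (i + s) < g d" unfolding d IH by (simp add: fle)
      then have d1: "i + s + 1 \<le> d" by (simp add: fle)
      have "d = i + s + 1"
      proof (rule ccontr)
        assume "d \<noteq> i + s + 1"
        then have lt: "f i < g (i + s + 1)" "g (i + s + 1) < f (i + 1)"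
          using d1 fle(3)[of "i + s" "i + s + 1"] fle(3)[of "i + s + 1" d] d IH by auto
        have "f a \<le> f i" "f (i + 1) \<le> f b" using fle step b by auto
        then have "g (i + s + 1) \<in> range f" using ran[of "g (i + s + 1)"] lt by simp
        then obtain e where e: "g (i + s + 1) = f e" by auto
        with lt have "i < e" "e < i + 1" by (simp_all add: fle)
        then show False by simp
      qed
      then show "g (i + 1 + s) = f (i + 1)" using d by (simp add: ac_simps)
    qed
  qed
  then show ?thesis by (intro exI[of _ s]) auto
qed

text \<open>Derivation is continuous up to shifts: a window of \<open>derived u\<close> depends only
  on a longer window of \<open>u\<close>. The shift invariance of \<open>X\<close> absorbs the index
  shift that remains.\<close>

lemma derived_window_closure:
  assumes u: "u \<in> window_closure Y" "admissible u" and Y: "\<And>v. v \<in> Y \<Longrightarrow> admissible v \<and> derived v \<in> X"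
    and X: "\<And>v s. v \<in> X \<Longrightarrow> (\<lambda>n. v (n + s)) \<in> X"
  shows "derived u \<in> window_closure X"
proof -
  obtain f where f: "strict_mono f" "range f = {n. sandwiched u n}" "derived u = u \<circ> f"
    by (rule derived_enumeration[OF u(2)])
  have "\<exists>x\<in>X. \<forall>n. \<bar>n\<bar> \<le> N \<longrightarrow> x n = derived u n" if "0 \<le> N" for N
  proof -
    \<comment> \<open>The extra 1 leaves room for the two neighbours that decide whether a letter is
      sandwiched.\<close>
    define M where "M = max \<bar>f (- N)\<bar> \<bar>f N\<bar> + 1"
    have M: "\<bar>m\<bar> < M" if "f (- N) \<le> m" "m \<le> f N" for m using that unfolding M_def by linarith
    obtain v where v: "v \<in> Y" "\<And>n. \<bar>n\<bar> \<le> M \<Longrightarrow> v n = u n"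
        using window_closureE[OF u(1), where N = M] by blast
    obtain g where g: "strict_mono g" "range g = {n. sandwiched v n}" "derived v = v \<circ> g"
      using Y[OF v(1)] derived_enumeration by metis
    have "m \<in> range f \<longleftrightarrow> m \<in> range g" if "f (- N) \<le> m" "m \<le> f N" for m
    proof -
      have "v (m - 1) = u (m - 1)" "v (m + 1) = u (m + 1)" using M[OF that] by (auto intro!: v(2))
      then show ?thesis unfolding f(2) g(2) by (simp add: sandwiched_def)
    qed
    then obtain s where s: "\<forall>i\<in>{- N..N}. g (i + s) = f i"
      using enumerations_agree[OF f(1) g(1), of "- N" N] \<open>0 \<le> N\<close>
          by (meson neg_le_0_iff_le order_trans)
    have "derived v (n + s) = derived u n" if "\<bar>n\<bar> \<le> N" for n
    proof -
      have "f (- N) \<le> f n" "f n \<le> f N" using that f(1) by (auto simp: strict_mono_less_eq)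
      then have "v (f n) = u (f n)" using M[of "f n"] by (intro v(2)) simp
      moreover have "n \<in> {- N..N}" using that by auto
      then have "g (n + s) = f n" using s by blast
      ultimately show ?thesis unfolding f(3) g(3) by simp
    qed
    moreover have "(\<lambda>n. derived v (n + s)) \<in> X" using X Y[OF v(1)] by blast
    ultimately show ?thesis by (intro bexI[of _ "\<lambda>n. derived v (n + s)"]) auto
  qed
  then have "\<exists>x\<in>X. \<forall>n. \<bar>n\<bar> \<le> N \<longrightarrow> x n = derived u n" for N
    by (cases "0 \<le> N") (blast, metis abs_ge_zero linorder_linear order_trans)
  then show ?thesis by (rule window_closureI)
qed

section \<open>Interval exchanges coding the directions of the first sector\<close>

lemma diagram_perm_simps:
  "diagram_perm 0 = id"
  "diagram_perm 1 A = D" "diagram_perm 1 B = C" "diagram_perm 1 C = B" "diagram_perm 1 D = A"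
  "diagram_perm 2 A = B" "diagram_perm 2 B = C" "diagram_perm 2 C = D" "diagram_perm 2 D = A"
  "diagram_perm 3 A = C" "diagram_perm 3 B = B" "diagram_perm 3 C = A" "diagram_perm 3 D = D"
  "diagram_perm 4 A = C" "diagram_perm 4 B = D" "diagram_perm 4 C = A" "diagram_perm 4 D = B"
  "diagram_perm 5 A = B" "diagram_perm 5 B = A" "diagram_perm 5 C = D" "diagram_perm 5 D = C"
  "diagram_perm 6 A = D" "diagram_perm 6 B = A" "diagram_perm 6 C = B" "diagram_perm 6 D = C"
  "diagram_perm 7 A = A" "diagram_perm 7 B = D" "diagram_perm 7 C = C" "diagram_perm 7 D = B"
  by (simp_all add: diagram_perm_def transpose_def)

lemmas diagram_perm_Suc_0 = diagram_perm_simps(2-5)[unfolded One_nat_def]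

text \<open>
  A direction \<open>\<theta>\<close> of the first sector is encoded by \<open>p = sin \<theta>\<close>, the projected length of side \<open>A\<close>,
  and \<open>p + q = sin (\<theta> +
      3 * pi / 4)\<close>, the projected length of side \<open>D\<close>, up to a common positive factor.
\<close>

definition len :: "real \<Rightarrow> real \<Rightarrow> letter \<Rightarrow> real" where
  "len p q L = (case L of A \<Rightarrow> p | B \<Rightarrow> p + sqrt 2 * p + q
     | C \<Rightarrow> p + sqrt 2 * p + sqrt 2 * q | D \<Rightarrow> p + q)"

definition top_pos :: "real \<Rightarrow> real \<Rightarrow> letter \<Rightarrow> real" where
  "top_pos p q L = (case L of A \<Rightarrow> 0 | B \<Rightarrow> len p q A | C \<Rightarrow> len p q A + len p q B
     | D \<Rightarrow> len p q A + len p q B + len p q C)"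

definition bot_pos :: "real \<Rightarrow> real \<Rightarrow> letter \<Rightarrow> real" where
  "bot_pos p q L = (case L of D \<Rightarrow> 0 | C \<Rightarrow> len p q D | B \<Rightarrow> len p q D + len p q C
     | A \<Rightarrow> len p q D + len p q C + len p q B)"

definition disp :: "real \<Rightarrow> real \<Rightarrow> letter \<Rightarrow> real" where
  "disp p q L = bot_pos p q L - top_pos p q L"

text \<open>The intervals are open because their endpoints come from vertices, which a trajectory
  never hits.\<close>

definition inside :: "real \<Rightarrow> real \<Rightarrow> real \<Rightarrow> letter \<Rightarrow> bool" where
  "inside p q t L \<longleftrightarrow> top_pos p q L < t \<and> t < top_pos p q L + len p q L"

text \<open>Both boundary directions belong to the sector: \<open>p = 0\<close> is the angle 0,
  where the interval of \<open>A\<close> is empty, and \<open>q = 0\<close> is the angle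
  \<open>pi / 8\<close>.\<close>

definition sector :: "real \<Rightarrow> real \<Rightarrow> bool" where
  "sector p q \<longleftrightarrow> 0 \<le> p \<and> 0 \<le> q \<and> 0 < p + q"

text \<open>All lengths and endpoints are combinations of \<open>p\<close> and \<open>q\<close> over
  the ring generated by \<open>sqrt 2\<close>; the four entries are their integer coordinates, so
  the renormalization becomes a table of integers.\<close>

fun lin :: "real \<Rightarrow> real \<Rightarrow> real \<times> real \<times> real \<times> real \<Rightarrow> real" where
  "lin p q (a, b, c, d) = a * p + b * (sqrt 2 * p) + c * q + d * (sqrt 2 * q)"

definition letter_index :: "letter \<Rightarrow> nat" where
  "letter_index L = (case L of A \<Rightarrow> 0 | B \<Rightarrow> 1 | C \<Rightarrow> 2 | D \<Rightarrow> 3)"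

text \<open>
  If \<open>(p, q)\<close> encodes the renormalized direction, \<open>parent j p q\<close> encodes the original one, in
  subsector \<open>j\<close>, and \<open>lift j L p q\<close> maps the renormalized interval of \<open>diagram_perm j L\<close>
      isometrically
  onto the set of points that are coded by a sandwiched \<open>L\<close>. The constants are found by comparing
  the lengths and the left endpoints of these intervals.
\<close>

definition parent :: "nat \<Rightarrow> real \<Rightarrow> real \<Rightarrow> real \<times> real" where
  "parent j p q = map_prod (lin p q) (lin p q)
     ([((1, 0, 0, 0), (0, 0, 1, 0)),
       ((1, 0, 1, 0), (0, 0, 1, 0)),
       ((1, 1, 1, 0), (2, 1, 1, 0)),
       ((1, 1, 0, 1), (2, 1, 1, 1)),
       ((1, 1, 0, 1), (2, 2, 1, 1)),
       ((1, 1, 1, 0), (2, 2, 1, 1)),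
       ((1, 0, 1, 0), (2, 1, 1, 1)),
       ((1, 0, 0, 0), (2, 1, 1, 0))] ! j)"

definition lift :: "nat \<Rightarrow> letter \<Rightarrow> real \<Rightarrow> real \<Rightarrow> real \<Rightarrow> real" where
  "lift j L p q y = (if odd j then y else - y) + lin p q
    ([[],
      [(-3, -2, -1, -1), (-1, -1, 1, 0), (1, 1, 3, 2), (3, 2, 5, 3)],
      [(2, 1, 1, 0), (6, 4, 3, 1), (12, 8, 5, 3), (13, 9, 5, 3)],
      [(-2, -1, -1, 0), (2, 2, 1, 2), (8, 6, 5, 4), (9, 7, 6, 5)],
      [(3, 2, 1, 1), (7, 5, 3, 3), (10, 7, 5, 4), (16, 11, 8, 6)],
      [(-1, 0, 0, 0), (3, 3, 2, 1), (6, 5, 3, 2), (12, 9, 6, 4)],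
      [(4, 2, 2, 1), (3, 1, 2, 1), (7, 4, 5, 3), (11, 7, 8, 5)],
      [(0, 0, 0, 0), (-1, -1, -1, -1), (3, 2, 0, 0), (7, 5, 1, 1)]]
     ! j ! letter_index L)"

text \<open>
  Letters that are not sandwiched force the next letter, so that blocks between consecutive
      sandwiched
  letters follow the path \<open>zigzag\<close>, which contains each of the seven transitions of diagram 0 once.
\<close>

definition zigzag :: "letter list" where
  "zigzag = [A, D, B, C, C, B, D, A]"

text \<open>The first letter of a block is sandwiched by its successor and the last one by its
  predecessor, so the two outermost pairs decide whether both sandwiched letters are in the
  group.\<close>

definition blocks :: "nat \<Rightarrow> letter list set" where
  "blocks k = {W. (\<exists>i l. 0 < l \<and> i + l \<le> 7 \<and> W = take (Suc l) (drop i zigzag)) \<and>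
     (W ! 1, hd W) \<in> sandwich_group k \<and> (last (butlast W), last W) \<in> sandwich_group k}"

text \<open>In diagram 0 a letter has at most two neighbours, hence a letter that is not sandwiched
  has its successor forced by its predecessor. The letter \<open>A\<close> has the single neighbour
  \<open>D\<close> and is always sandwiched, so no block goes past the ends of
  \<open>zigzag\<close>.\<close>

lemma block_between_sandwiched:
  assumes adm: "admissible_0 u" and grp: "\<And>n L. sandwiched_by L u n \<Longrightarrow> (L, u n) \<in> sandwich_group k"
    and m: "sandwiched u m" "sandwiched u m'" "m < m'" "\<And>i. m < i \<Longrightarrow> i < m' \<Longrightarrow> \<not> sandwiched u i"
  shows "map u [m..m'] \<in> blocks k"
proof -
  define a where "a i = u (m + int i)" for i
  obtain g where g: "m' = m + int g" "0 < g" using m(3) by (metis zless_iff_Suc_zadd zero_less_Suc)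
  have tr: "(a i, a (Suc i)) \<in> {(A, D), (D, A), (D, B), (B, D), (B, C), (C, B), (C, C)}" for i
    using adm[unfolded admissible_0_def, rule_format, of "m + int i"] by (simp add: a_def ac_simps)
  \<comment> \<open>The first transition locates the start of the block, since each transition
    occurs once on \<open>zigzag\<close>.\<close>
  have "\<exists>o' \<in> {0, 1, 2, 3, 4, 5, 6}. a 0 = zigzag ! o' \<and> a 1 = zigzag ! (Suc o')"
    using tr[of 0] by (auto simp: zigzag_def)
  then obtain o' where o': "o' \<in> {0, 1, 2, 3, 4, 5, 6}" "a 0 = zigzag ! o'"
      "a 1 = zigzag ! (Suc o')" by blast
  have path: "o' + Suc i \<le> 7 \<and> a i = zigzag ! (o' + i) \<and> a (Suc i) = zigzag ! (o' + Suc i)"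
      if "i < g" for i
    using that
  proof (induction i)
    case 0
    show ?case using o' by auto
  next
    case (Suc i)
    have ns: "a i \<noteq> a (Suc (Suc i))"
      using m(4)[of "m + 1 + int i"] Suc.prems g by (simp add: a_def sandwiched_def ac_simps)
    define l where "l = o' + i"
    have l: "l \<le> 6" "a i = zigzag ! l" "a (Suc i) = zigzag ! (Suc l)" using Suc
        by (auto simp: l_def)
    then have "l \<in> {0, 1, 2, 3, 4, 5, 6}" by auto
    then have "Suc (Suc l) \<le> 7 \<and> a (Suc (Suc i)) = zigzag ! (Suc (Suc l))"
      using l(2,3) ns tr[of i] tr[of "Suc i"] by (auto simp: zigzag_def)
    then show ?case using l(3) by (simp add: l_def)
  qed
  from path[of "g - 1"] g have og: "o' + g \<le> 7" by simp
  have ai: "a i = zigzag ! (o' + i)" if "i \<le> g" for i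
    using path[of i] path[of "i - 1"] that g by (cases "i < g") auto
  have "map u [m..m'] = take (Suc g) (drop o' zigzag)"
    using ai og unfolding g by (intro nth_equalityI) (auto simp: a_def zigzag_def)
  then have ex: "\<exists>i l. 0 < l \<and> i + l \<le> 7 \<and> map u [m..m'] = take (Suc l) (drop i zigzag)"
    using og g(2) by blast
  have w1: "map u [m..m'] ! 1 = u (m + 1)" using m(3) by simp
  have w0: "hd (map u [m..m']) = u m" using m(3) by (simp add: upto_rec1)
  have "[m..m'] = [m..m' - 1 - 1] @ [m' - 1, m']"
    using m(3) by (simp add: upto_rec2)
  then have wl: "last (butlast (map u [m..m'])) = u (m' - 1)" "last (map u [m..m']) = u m'"
    by (simp_all add: butlast_append)
  have gr: "(u (m + 1), u m) \<in> sandwich_group k" "(u (m' - 1), u m') \<in> sandwich_group k"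
    using grp[of "u (m + 1)" m] grp[of "u (m' - 1)" m'] m(1,2)
        by (simp_all add: sandwiched_def sandwiched_by_def)
  show ?thesis unfolding blocks_def mem_Collect_eq w1 w0 wl using ex gr by blast
qed

text \<open>A path of eight letters has 28 pieces with at least two letters. Listing them reduces
  statements about blocks to finitely many linear checks.\<close>

lemma block_cases:
  assumes "W \<in> blocks k"
  shows "W \<in> {[A, D], [A, D, B], [A, D, B, C], [A, D, B, C, C], [A, D, B, C, C, B],
    [A, D, B, C, C, B, D], [A, D, B, C, C, B, D, A], [D, B], [D, B, C], [D, B, C, C],
    [D, B, C, C, B], [D, B, C, C, B, D], [D, B, C, C, B, D, A], [B, C], [B, C, C], [B, C, C, B],
    [B, C, C, B, D], [B, C, C, B, D, A], [C, C], [C, C, B], [C, C, B, D], [C, C, B, D, A],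
    [C, B], [C, B, D], [C, B, D, A], [B, D], [B, D, A], [D, A]}"
    and "(W ! 1, hd W) \<in> sandwich_group k" "(last (butlast W), last W) \<in> sandwich_group k"
proof -
  obtain i l where il: "0 < l" "i + l \<le> 7" "W = take (Suc l) (drop i zigzag)"
      using assms unfolding blocks_def by blast
  then have "i = 0 \<or> i = 1 \<or> i = 2 \<or> i = 3 \<or> i = 4 \<or> i = 5 \<or> i = 6"
    "l = 1 \<or> l = 2 \<or> l = 3 \<or> l = 4 \<or> l = 5 \<or> l = 6 \<or> l = 7" by linarith+
  with il show "W \<in> {[A, D], [A, D, B], [A, D, B, C], [A, D, B, C, C], [A, D, B, C, C, B],
    [A, D, B, C, C, B, D], [A, D, B, C, C, B, D, A], [D, B], [D, B, C], [D, B, C, C],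
    [D, B, C, C, B], [D, B, C, C, B, D], [D, B, C, C, B, D, A], [B, C], [B, C, C], [B, C, C, B],
    [B, C, C, B, D], [B, C, C, B, D, A], [C, C], [C, C, B], [C, C, B, D], [C, C, B, D, A],
    [C, B], [C, B, D], [C, B, D, A], [B, D], [B, D, A], [D, A]}"
    by (elim disjE; simp add: zigzag_def)
qed (use assms in \<open>auto simp: blocks_def\<close>)

section \<open>Verification of the renormalization tables\<close>

fun run :: "real \<Rightarrow> real \<Rightarrow> real \<Rightarrow> letter list \<Rightarrow> bool" where
  "run p q t [] = True"
| "run p q t (L # W) = (inside p q t L \<and> run p q (t + disp p q L) W)"

lemmas pos_simps = inside_def top_pos_def bot_pos_def disp_def

lemma sqrt2_sqrt2: "sqrt 2 * (sqrt 2 * x) = 2 * x"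
  by simp

text \<open>When the tables are checked, \<open>sqrt 2 * p\<close> and \<open>sqrt 2 * q\<close> are
  treated as independent variables. The bounds 7/5 and 3/2 on \<open>sqrt 2\<close> are sharp enough
  for linear arithmetic to settle every comparison.\<close>

lemma sqrt2_bounds:
  assumes "0 \<le> p"
  shows "7 * p \<le> 5 * (sqrt 2 * p)" "2 * (sqrt 2 * p) \<le> 3 * p"
proof -
  have "7 / 5 \<le> sqrt 2" by (rule real_le_rsqrt) (simp add: power2_eq_square)
  moreover have "sqrt 2 \<le> 3 / 2" by (rule real_le_lsqrt) (simp_all add: power2_eq_square)
  ultimately have "7 / 5 * p \<le> sqrt 2 * p" "sqrt 2 * p \<le> 3 / 2 * p"
    using assms by (intro mult_right_mono; simp)+
  then show "7 * p \<le> 5 * (sqrt 2 * p)" "2 * (sqrt 2 * p) \<le> 3 * p" by linarith+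
qed

lemma index_cases:
  assumes "j \<in> {1..7::nat}"
  obtains "j = 1" | "j = 2" | "j = 3" | "j = 4" | "j = 5" | "j = 6" | "j = 7"
proof -
  have "j \<in> {1, 2, 3, 4, 5, 6, 7}" using assms by auto
  with that show thesis by blast
qed

lemma nth_row:
  "[a0, a1, a2, a3, a4, a5, a6, a7] ! 1 = a1" "[a0, a1, a2, a3, a4, a5, a6, a7] ! 2 = a2"
  "[a0, a1, a2, a3, a4, a5, a6, a7] ! 3 = a3" "[a0, a1, a2, a3, a4, a5, a6, a7] ! 4 = a4"
  "[a0, a1, a2, a3, a4, a5, a6, a7] ! 5 = a5" "[a0, a1, a2, a3, a4, a5, a6, a7] ! 6 = a6"
  "[a0, a1, a2, a3, a4, a5, a6, a7] ! 7 = a7"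
  by simp_all

lemma nth_letter_index:
  "[a, b, c, d] ! letter_index L = (case L of A \<Rightarrow> a | B \<Rightarrow> b | C \<Rightarrow> c | D \<Rightarrow> d)"
  by (cases L) (simp_all add: letter_index_def)

lemma sandwich_group_half:
  "sandwich_group (1 div 2) = {(D, A), (C, B), (B, C), (A, D)}"
  "sandwich_group (2 div 2) = {(D, A), (C, B), (B, C), (B, D)}"
  "sandwich_group (3 div 2) = {(D, A), (C, B), (B, C), (B, D)}"
  "sandwich_group (4 div 2) = {(D, A), (C, B), (C, C), (B, D)}"
  "sandwich_group (5 div 2) = {(D, A), (C, B), (C, C), (B, D)}"
  "sandwich_group (6 div 2) = {(D, A), (D, B), (C, C), (B, D)}"
  "sandwich_group (7 div 2) = {(D, A), (D, B), (C, C), (B, D)}"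
  by (simp_all add: sandwich_group_def)

lemmas table_simps = lift_def nth_row nth_letter_index sandwich_group_half diagram_perm_simps
  letter.case letter.distinct prod.inject insert_iff empty_iff simp_thms
  if_True if_False odd_one even_numeral odd_numeral
  lin.simps top_pos_def bot_pos_def disp_def inside_def

lemma list_eval: "hd (x # xs) = x" "last [x] = x" "last (x # y # xs) = last (y # xs)"
    "butlast [x] = []"
  "butlast (x # y # xs) = x # butlast (y # xs)" "map f [] = []" "map f (x # xs) = f x # map f xs"
  "sum_list [] = (0::real)" "sum_list (z # zs) = z + sum_list zs"
      "(x # y # xs) ! 1 = y" for z :: real
  by simp_all

definition transitions :: "(letter \<times> letter) set" where
  "transitions = {(A, D), (D, A), (D, B), (B, D), (B, C), (C, B), (C, C)}"

text \<open>The image of the interval of \<open>L\<close> overlaps only the intervals of the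
  neighbours of \<open>L\<close> in diagram 0; every other overlap contradicts the inequalities
  between the lengths.\<close>

lemma inside_admissible:
  assumes "sector p q" "inside p q t L" "inside p q (t + disp p q L) L'"
  shows "(L, L') \<in> transitions"
proof -
  define P where "P = sqrt 2 * p"
  define Q where "Q = sqrt 2 * q"
  have "0 \<le> p" "0 \<le> q" "7 * p \<le> 5 * P" "2 * P \<le> 3 * p" "7 * q \<le> 5 * Q" "2 * Q \<le> 3 * q"
    using assms(1) sqrt2_bounds[of p] sqrt2_bounds[of q] by (auto simp: sector_def P_def Q_def)
  with assms(2,3) show ?thesis
    by (cases L; cases L'; simp add: pos_simps len_def transitions_def flip: P_def Q_def)
qed

text \<open>Here \<open>(p, q)\<close> is the direction after renormalization and
  \<open>(p0, q0)\<close> the one before it. In this parametrization the same linear data serve both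
  for deriving and for generating words.\<close>

locale child =
  fixes j :: nat and p q p0 q0 :: real
  assumes index: "j \<in> {1..7}" and parent: "parent j p q = (p0, q0)" and sector: "sector p q"
begin

lemma sqrt2_abstract:
  obtains P Q where "P = sqrt 2 * p" "Q = sqrt 2 * q" "0 \<le> p" "0 \<le> q" "0 < p + q"
    "7 * p \<le> 5 * P" "2 * P \<le> 3 * p" "7 * q \<le> 5 * Q" "2 * Q \<le> 3 * q"
  using sector sqrt2_bounds[of p] sqrt2_bounds[of q] that unfolding sector_def by blast

text \<open>With the parent lengths written in child coordinates, each comparison of intervals is a
  linear inequality in four quantities.\<close>

lemma child_cases:
  obtains "j = 1" "len p0 q0 = case_letter (lin p q (1, 0, 1, 0)) (lin p q (1, 1, 2, 1)) (lin p q
      (1, 1, 1, 2)) (lin p q (1, 0, 2, 0))"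
  | "j = 2" "len p0 q0 = case_letter (lin p q (1, 1, 1, 0)) (lin p q (5, 3, 2, 1)) (lin p q (5,
      4, 1, 2)) (lin p q (3, 2, 2, 0))"
  | "j = 3" "len p0 q0 = case_letter (lin p q (1, 1, 0, 1)) (lin p q (5, 3, 3, 2)) (lin p q (5,
      4, 4, 2)) (lin p q (3, 2, 1, 2))"
  | "j = 4" "len p0 q0 = case_letter (lin p q (1, 1, 0, 1)) (lin p q (5, 4, 3, 2)) (lin p q (7,
      4, 4, 2)) (lin p q (3, 3, 1, 2))"
  | "j = 5" "len p0 q0 = case_letter (lin p q (1, 1, 1, 0)) (lin p q (5, 4, 2, 2)) (lin p q (7,
      4, 3, 2)) (lin p q (3, 3, 2, 1))"
  | "j = 6" "len p0 q0 = case_letter (lin p q (1, 0, 1, 0)) (lin p q (3, 2, 2, 2)) (lin p q (3,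
      3, 3, 2)) (lin p q (3, 1, 2, 1))"
  | "j = 7" "len p0 q0 = case_letter (lin p q (1, 0, 0, 0)) (lin p q (3, 2, 1, 0)) (lin p q (3,
      3, 0, 1)) (lin p q (3, 1, 1, 0))"
proof -
  have ext: "len p0 q0 = case_letter a b c d"
    if "len p0 q0 A = a" "len p0 q0 B = b" "len p0 q0 C = c" "len p0 q0 D = d" for a b c d
    using that by (auto split: letter.split)
  note eval = parent_def len_def distrib_left sqrt2_sqrt2
  show thesis
    using parent
    by (cases rule: index_cases[OF index])
      ((rule that, assumption, rule ext; auto simp: eval simp flip: mult.assoc)+)
qed

text \<open>A point coded by an \<open>L'\<close>-sandwiched \<open>L\<close> lies in the image of
  the interval of \<open>L'\<close>, in the interval of \<open>L\<close>, and in the preimage of the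
  interval of \<open>L'\<close>. This intersection is empty unless the pair is in the group, and
  otherwise it is contained in the lift of a child interval.\<close>

lemma sandwiched_inside:
  assumes "inside p0 q0 (t - disp p0 q0 L') L'" "inside p0 q0 t L"
      "inside p0 q0 (t + disp p0 q0 L) L'"
  shows "(L', L) \<in> sandwich_group (j div 2)"
    and "\<exists>y. t = lift j L p q y \<and> inside p q y (diagram_perm j L)"
proof -
  obtain P Q where PQ: "P = sqrt 2 * p" "Q = sqrt 2 * q"
    and bd: "0 \<le> p" "0 \<le> q" "0 < p + q" "7 * p \<le> 5 * P" "2 * P \<le> 3 * p" "7 * q \<le> 5 * Q"
        "2 * Q \<le> 3 * q"
    by (rule sqrt2_abstract)
  note eval = table_simps len_def[of p q] PQ[symmetric]
  have t: "top_pos p0 q0 L < t" "t < top_pos p0 q0 L + len p0 q0 L"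
    "bot_pos p0 q0 L' < t" "t < bot_pos p0 q0 L' + len p0 q0 L'"
    "top_pos p0 q0 L' < t + disp p0 q0 L" "t + disp p0 q0 L < top_pos p0 q0 L' + len p0 q0 L'"
    using assms unfolding inside_def disp_def by linarith+
  show group: "(L', L) \<in> sandwich_group (j div 2)"
  proof (rule ccontr)
    assume "\<not> ?thesis"
    with t bd show False
      by (cases rule: child_cases; hypsubst; cases L; cases L'; simp only: eval; linarith)
  qed
  \<comment> \<open>The isometry reverses orientation for even \<open>j\<close>, so its inverse has
    two forms; the lift of 0 is its constant term.\<close>
  define y where "y = (if odd j then t - lift j L p q 0 else lift j L p q 0 - t)"
  have "t = lift j L p q y" by (simp add: y_def lift_def)
  moreover have "inside p q y (diagram_perm j L)"
    using group t bd unfolding y_def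
    by (cases rule: child_cases; hypsubst;
      simp only: sandwich_group_half insert_iff empty_iff prod.inject simp_thms;
      elim disjE conjE; hypsubst; simp only: eval; intro conjI; linarith)
  ultimately show "\<exists>y. t = lift j L p q y \<and> inside p q y (diagram_perm j L)" by blast
qed

text \<open>This supplies the initial position when an orbit of the parent is generated from one of
  the child.\<close>

lemma inside_lift:
  assumes "(L', L) \<in> sandwich_group (j div 2)" "inside p q y (diagram_perm j L)"
  shows "inside p0 q0 (lift j L p q y) L"
proof -
  obtain P Q where PQ: "P = sqrt 2 * p" "Q = sqrt 2 * q"
    and bd: "0 \<le> p" "0 \<le> q" "0 < p + q" "7 * p \<le> 5 * P" "2 * P \<le> 3 * p" "7 * q \<le> 5 * Q"
        "2 * Q \<le> 3 * q"
    by (rule sqrt2_abstract)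
  note eval = table_simps len_def[of p q] PQ[symmetric]
  show ?thesis
    using assms bd
    by (cases rule: child_cases; hypsubst;
      simp only: sandwich_group_half insert_iff empty_iff prod.inject simp_thms;
      elim disjE conjE; hypsubst; simp only: eval; intro conjI; linarith)
qed

text \<open>Crossing a whole block with the parent exchange amounts to one step of the child
  exchange. After expansion \<open>y\<close> cancels and an identity between table entries
  remains.\<close>

lemma lift_block:
  assumes "W \<in> blocks (j div 2)"
  shows "lift j (hd W) p q y + sum_list (map (disp p0 q0) (butlast W)) =
    lift j (last W) p q (y + disp p q (diagram_perm j (hd W)))"
proof -
  define P where "P = sqrt 2 * p"
  define Q where "Q = sqrt 2 * q"
  note eval = table_simps len_def[of p q] P_def[symmetric] Q_def[symmetric]
  show ?thesis
    using block_cases[OF assms]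
    by (simp only: insert_iff empty_iff simp_thms; elim disjE; hypsubst;
      cases rule: child_cases; hypsubst; simp only: list_eval eval; linarith)
qed

text \<open>The end letters of the block, permuted by the diagram, must form an admissible pair,
  which rules out some blocks; for the others every intermediate position satisfies linear
  inequalities implied by the positions of the two ends in the child.\<close>

lemma run_block:
  assumes "W \<in> blocks (j div 2)" "inside p q y (diagram_perm j (hd W))"
    "inside p q (y + disp p q (diagram_perm j (hd W))) (diagram_perm j (last W))"
  shows "run p0 q0 (lift j (hd W) p q y) W"
proof -
  obtain P Q where PQ: "P = sqrt 2 * p" "Q = sqrt 2 * q"
    and bd: "0 \<le> p" "0 \<le> q" "0 < p + q" "7 * p \<le> 5 * P" "2 * P \<le> 3 * p" "7 * q \<le> 5 * Q"
        "2 * Q \<le> 3 * q"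
    by (rule sqrt2_abstract)
  note eval = table_simps len_def[of p q] PQ[symmetric]
  show ?thesis
    using block_cases[OF assms(1)] inside_admissible[OF sector assms(2,3)] assms(2,3) bd
    apply (simp only: insert_iff empty_iff simp_thms; elim disjE; hypsubst;
      cases rule: child_cases; hypsubst)
    apply (simp_all only: list_eval transitions_def diagram_perm_simps sandwich_group_half
      insert_iff empty_iff prod.inject letter.distinct simp_thms)
    apply (simp_all only: run.simps eval)
    apply (intro conjI; linarith)+
    done
qed

lemma sector_parent: "sector p0 q0"
proof -
  obtain P Q where PQ: "P = sqrt 2 * p" "Q = sqrt 2 * q"
    and bd: "0 \<le> p" "0 \<le> q" "0 < p + q" "7 * p \<le> 5 * P" "2 * P \<le> 3 * p" "7 * q \<le> 5 * Q"
        "2 * Q \<le> 3 * q"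
    by (rule sqrt2_abstract)
  show ?thesis
    using parent bd
    by (cases rule: index_cases[OF index]; simp add: parent_def sector_def flip: PQ; linarith)
qed

end

text \<open>The seven linear maps \<open>parent j\<close> carry the cone of directions onto subcones
  that cover it. In each case the matrix is inverted, and the case conditions say that the
  coordinates obtained are nonnegative.\<close>

lemma exists_child:
  assumes "sector p0 q0"
  shows "\<exists>j p q. child j p q p0 q0"
proof -
  define r where "r = sqrt 2"
  have r: "r * r = 2" "0 < r" "\<And>x. r * (r * x) = 2 * x" by (simp_all add: r_def)
  have nz: "0 < x + y" if "0 \<le> x" "0 \<le> y" "parent j x y = (p0, q0)" "j \<in> {1..7}" for j x y
  proof (rule ccontr)
    assume "\<not> ?thesis"
    then have "x = 0" "y = 0" using that by auto
    then show False using that(3) assms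
        by (cases rule: index_cases[OF that(4)]) (simp_all add: parent_def sector_def)
  qed
  have ch: "?thesis" if "0 \<le> x" "0 \<le> y" "parent j x y = (p0, q0)" "j \<in> {1..7}" for j x y
    using nz[OF that] that unfolding child_def sector_def by blast
  have pq: "0 \<le> p0" "0 \<le> q0" using assms by (auto simp: sector_def)
  \<comment> \<open>In terms of \<open>q0 / p0\<close> the subsectors are separated by 1,
    \<open>sqrt 2\<close>, \<open>1 + sqrt 2 / 2\<close>, 2, \<open>1 + sqrt 2\<close> and
    \<open>2 + sqrt 2\<close>.\<close>
  consider "q0 \<le> p0" | "p0 \<le> q0" "(1 + r) * q0 \<le> (2 + r) * p0"
    | "(2 + r) * p0 \<le> (1 + r) * q0" "r * q0 \<le> (1 + r) * p0"
    | "(1 + r) * p0 \<le> r * q0" "q0 \<le> 2 * p0"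
    | "2 * p0 \<le> q0" "q0 \<le> (1 + r) * p0"
    | "(1 + r) * p0 \<le> q0" "q0 \<le> (2 + r) * p0"
    | "(2 + r) * p0 \<le> q0" by linarith
  then show ?thesis
  proof cases
    case 1
    have "0 \<le> p0 - q0" "0 \<le> q0" using 1 pq r(2) by simp_all
    moreover have "parent 1 (p0 - q0) (q0) = (p0, q0)"
      by (simp add: parent_def flip: r_def; simp add: algebra_simps r(1,3))
    ultimately show ?thesis by (rule ch) simp
  next
    case 2
    have "0 \<le> q0 - p0" "0 \<le> (2 + r) * p0 - (1 + r) * q0" using 2 pq r(2) by simp_all
    moreover have "parent 2 (q0 - p0) ((2 + r) * p0 - (1 + r) * q0) = (p0, q0)"
      by (simp add: parent_def flip: r_def; simp add: algebra_simps r(1,3))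
    ultimately show ?thesis by (rule ch) simp
  next
    case 3
    have "0 \<le> (1 + r) * p0 - r * q0" "0 \<le> (1 + r) * q0 - (2 + r) * p0" using 3 pq r(2) by simp_all
    moreover have "parent 3 ((1 + r) * p0 - r * q0) ((1 + r) * q0 - (2 + r) * p0) = (p0, q0)"
      by (simp add: parent_def flip: r_def; simp add: algebra_simps r(1,3))
    ultimately show ?thesis by (rule ch) simp
  next
    case 4
    have "0 \<le> r * q0 - (1 + r) * p0" "0 \<le> (1 + r) * (2 * p0 - q0)" using 4 pq r(2) by simp_all
    moreover have "parent 4 (r * q0 - (1 + r) * p0) ((1 + r) * (2 * p0 - q0)) = (p0, q0)"
      by (simp add: parent_def flip: r_def; simp add: algebra_simps r(1,3))
    ultimately show ?thesis by (rule ch) simp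
  next
    case 5
    have "0 \<le> (1 + r) * p0 - q0" "0 \<le> (1 + r) * (q0 - 2 * p0)" using 5 pq r(2) by simp_all
    moreover have "parent 5 ((1 + r) * p0 - q0) ((1 + r) * (q0 - 2 * p0)) = (p0, q0)"
      by (simp add: parent_def flip: r_def; simp add: algebra_simps r(1,3))
    ultimately show ?thesis by (rule ch) simp
  next
    case 6
    have "0 \<le> q0 - (1 + r) * p0" "0 \<le> (2 + r) * p0 - q0" using 6 pq r(2) by simp_all
    moreover have "parent 6 (q0 - (1 + r) * p0) ((2 + r) * p0 - q0) = (p0, q0)"
      by (simp add: parent_def flip: r_def; simp add: algebra_simps r(1,3))
    ultimately show ?thesis by (rule ch) simp
  next
    case 7
    have "0 \<le> p0" "0 \<le> q0 - (2 + r) * p0" using 7 pq r(2) by simp_all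
    moreover have "parent 7 (p0) (q0 - (2 + r) * p0) = (p0, q0)"
      by (simp add: parent_def flip: r_def; simp add: algebra_simps r(1,3))
    ultimately show ?thesis by (rule ch) simp
  qed
qed

section \<open>Orbits, derivation and generation\<close>

text \<open>The finite counterpart of \<open>code\<close>: generation reconstructs only windows, and
  positions outside \<open>{a..b}\<close> are left free.\<close>

definition orbit :: "real \<Rightarrow> real \<Rightarrow> bi_word \<Rightarrow> (int \<Rightarrow> real) \<Rightarrow> int \<Rightarrow> int \<Rightarrow> bool" where
  "orbit p q u x a b \<longleftrightarrow> (\<forall>i\<in>{a..b}. inside p q (x i) (u i)) \<and>
     (\<forall>i\<in>{a..<b}. x (i + 1) = x i + disp p q (u i))"

definition code :: "real \<Rightarrow> real \<Rightarrow> bi_word \<Rightarrow> (int \<Rightarrow> real) \<Rightarrow> bool" where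
  "code p q u x \<longleftrightarrow> (\<forall>i. inside p q (x i) (u i) \<and> x (i + 1) = x i + disp p q (u i))"

definition sector_codes :: "bi_word set" where
  "sector_codes = {u. \<exists>p q x. sector p q \<and> code p q u x}"

lemma sum_int_step:
  fixes g :: "int \<Rightarrow> real"
  assumes "a < b"
  shows "sum g {a..<b} = g a + sum g {a + 1..<b}"
proof -
  have "{a..<b} = insert a {a + 1..<b}" using assms by auto
  then show ?thesis by simp
qed

lemma sum_int_last:
  fixes g :: "int \<Rightarrow> real"
  assumes "a \<le> b"
  shows "sum g {a..<b + 1} = sum g {a..<b} + g b"
proof -
  have "{a..<b + 1} = insert b {a..<b}" using assms by auto
  then show ?thesis by simp
qed

lemma run_inside:
  assumes "run p q t (map u [a..b])" "i \<in> {a..b}"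
  shows "inside p q (t + (\<Sum>m\<in>{a..<i}. disp p q (u m))) (u i)"
  using assms
proof (induction "nat (i - a)" arbitrary: a t)
  case 0
  then have "i = a" by simp
  with 0 show ?case by (simp add: upto_rec1)
next
  case (Suc k)
  then have "a < i" "a \<le> b" by auto
  with Suc.prems have "run p q (t + disp p q (u a)) (map u [a + 1..b])" by (simp add: upto_rec1)
  then have "inside p q (t + disp p q (u a) + (\<Sum>m\<in>{a + 1..<i}. disp p q (u m))) (u i)"
    using Suc.hyps(2) Suc.prems(2) \<open>a < i\<close> by (intro Suc.hyps(1)) auto
  then show ?case using sum_int_step[OF \<open>a < i\<close>] by (simp add: add.assoc)
qed

lemma code_sum:
  assumes "code p q u x" "a \<le> b"
  shows "x b = x a + (\<Sum>m\<in>{a..<b}. disp p q (u m))"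
  using assms(2)
proof (induction b rule: int_ge_induct)
  case (step b)
  then show ?case using assms(1) sum_int_last[of a b "\<lambda>m. disp p q (u m)"] by (simp add: code_def)
qed simp

lemma code_admissible:
  assumes "sector p q" "code p q u x"
  shows "admissible_0 u"
proof -
  have "(u n, u (n + 1)) \<in> transitions" for n
    using assms(2) inside_admissible[OF assms(1), of "x n" "u n" "u (n + 1)"]
        unfolding code_def by metis
  then show ?thesis unfolding admissible_0_def transitions_def by blast
qed

lemma admissible_0_admissible: "admissible_0 u \<Longrightarrow> admissible u"
  unfolding admissible_def admissible_in_def by (intro exI[of _ 0]) (simp add: diagram_perm_simps)

lemma enumeration_gap:
  fixes f :: "int \<Rightarrow> int"
  assumes "strict_mono f" "range f = {n. P n}" "f r < i" "i < f (r + 1)"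
  shows "\<not> P i"
proof
  assume "P i"
  then obtain e where "i = f e" using assms(2) by auto
  with assms have "r < e" "e < r + 1" by (simp_all add: strict_mono_less)
  then show False by simp
qed

lemma map_upto_ends:
  assumes "m < (m'::int)"
  shows "hd (map u [m..m']) = u m" "last (map u [m..m']) = u m'"
    "sum_list (map g (butlast (map u [m..m']))) = (\<Sum>i\<in>{m..<m'}. (g (u i) :: real))"
proof -
  have e: "[m..m'] = [m..m' - 1] @ [m']" using assms by (simp add: upto_rec2)
  show "hd (map u [m..m']) = u m" using assms by (simp add: upto_rec1)
  show "last (map u [m..m']) = u m'" by (simp add: e)
  have "butlast (map u [m..m']) = map u [m..m' - 1]" by (simp add: e)
  moreover have "set [m..m' - 1] = {m..<m'}" by auto
  ultimately show "sum_list (map g (butlast (map u [m..m']))) = (\<Sum>i\<in>{m..<m'}. (g (u i) :: real))"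
    using sum.distinct_set_conv_list[of "[m..m' - 1]" "\<lambda>i. g (u i)"] by (simp add: comp_def)
qed

context child
begin

text \<open>Each sandwiched position is the lift of a point of the child, and by
  \<open>lift_block\<close> the passage to the next sandwiched position lifts one step of the child
  exchange. The lifted points thus form the required orbit.\<close>

lemma code_child:
  assumes x: "code p0 q0 u x"
  shows "admissible_0 u" and "\<And>n L. sandwiched_by L u n \<Longrightarrow> (L, u n) \<in> sandwich_group (j div 2)"
    and "\<exists>y. code p q (diagram_perm j \<circ> derived u) y"
proof -
  show adm: "admissible_0 u" by (rule code_admissible[OF sector_parent x])
  have ins: "inside p0 q0 (x n) (u n)" "x (n + 1) = x n + disp p0 q0 (u n)" for n
    using x by (auto simp: code_def)
  have prev: "x (n - 1) = x n - disp p0 q0 (u (n - 1))" for n using ins(2)[of "n - 1"] by simp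
  have sw: "inside p0 q0 (x n - disp p0 q0 L) L" "inside p0 q0 (x n + disp p0 q0 (u n)) L"
    if "sandwiched_by L u n" for n L
    using that ins(1)[of "n - 1"] ins(1)[of "n + 1"] ins(2)[of n] prev[of n]
        by (simp_all add: sandwiched_by_def)
  show grp: "(L, u n) \<in> sandwich_group (j div 2)" if "sandwiched_by L u n" for n L
    using sandwiched_inside(1)[OF sw(1)[OF that] ins(1) sw(2)[OF that]] .
  obtain f where f: "strict_mono f" "range f = {n. sandwiched u n}" "derived u = u \<circ> f"
    by (rule derived_enumeration[OF admissible_0_admissible[OF adm]])
  have sf: "sandwiched_by (u (f r + 1)) u (f r)" for r
    using f(2) unfolding sandwiched_by_def sandwiched_def by blast
  have "\<exists>y. x (f r) = lift j (u (f r)) p q y \<and> inside p q y (diagram_perm j (u (f r)))" for r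
    by (rule sandwiched_inside(2)[OF sw(1)[OF sf] ins(1) sw(2)[OF sf]])
  then obtain y where y: "\<And>r. x (f r) = lift j (u (f r)) p q (y r)"
    "\<And>r. inside p q (y r) (diagram_perm j (u (f r)))" by metis
  have "y (r + 1) = y r + disp p q (diagram_perm j (u (f r)))" for r
  proof -
    have lt: "f r < f (r + 1)" using f(1) by (simp add: strict_mono_less)
    have "map u [f r..f (r + 1)] \<in> blocks (j div 2)"
    proof (rule block_between_sandwiched[OF adm grp _ _ lt])
      show "sandwiched u (f r)" "sandwiched u (f (r + 1))" using f(2) by blast+
      show "\<not> sandwiched u i" if "f r < i" "i < f (r + 1)" for i
        by (rule enumeration_gap[OF f(1,2) that])
    qed
    \<comment> \<open>Two expressions for the position at \<open>f (r + 1)\<close> are compared; the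
      lift is injective, so the child positions agree.\<close>
    from lift_block[OF this, of "y r"] have "x (f r) + (\<Sum>i\<in>{f r..<f (r + 1)}. disp p0 q0 (u i)) =
        lift j (u (f (r + 1))) p q (y r + disp p q (diagram_perm j (u (f r))))"
      unfolding map_upto_ends[OF lt] y(1) .
    moreover have "x (f (r + 1)) = x (f r) + (\<Sum>i\<in>{f r..<f (r + 1)}. disp p0 q0 (u i))"
      using code_sum[OF x, of "f r" "f (r + 1)"] lt by simp
    ultimately show ?thesis using y(1)[of "r + 1"] by (simp add: lift_def split: if_splits)
  qed
  with y(2) have "code p q (diagram_perm j \<circ> derived u) y" by (simp add: code_def f(3))
  then show "\<exists>y. code p q (diagram_perm j \<circ> derived u) y" by blast
qed

text \<open>Generation inverts derivation on windows: the letters between sandwiched ones are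
  forced, so the orbit is extended block by block, with adjacent blocks glued at their common
  sandwiched position.\<close>

lemma orbit_parent:
  assumes adm: "admissible_0 u" and grp: "\<And>n L. sandwiched_by L u n \<Longrightarrow>
      (L, u n) \<in> sandwich_group (j div 2)"
    and f: "strict_mono f" "range f = {n. sandwiched u n}"
    and y: "orbit p q (diagram_perm j \<circ> u \<circ> f) y a b" and ab: "a \<le> b"
  shows "\<exists>x. orbit p0 q0 u x (f a) (f b) \<and> x (f b) = lift j (u (f b)) p q (y b)"
proof -
  have iny: "inside p q (y i) (diagram_perm j (u (f i)))" if "a \<le> i" "i \<le> b" for i
    using y that by (simp add: orbit_def)
  have stepy: "y (i + 1) = y i + disp p q (diagram_perm j (u (f i)))" if "a \<le> i" "i < b" for i
    using y that by (simp add: orbit_def)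
  have sf: "sandwiched u (f r)" for r using f(2) by blast
  have "i \<le> b \<longrightarrow> (\<exists>x. orbit p0 q0 u x (f a) (f i) \<and> x (f i) = lift j (u (f i)) p q (y i))"
      if "a \<le> i" for i
    using that
  proof (induction i rule: int_ge_induct)
    case base
    have "(u (f a + 1), u (f a)) \<in> sandwich_group (j div 2)"
      using sf[of a] by (intro grp) (simp add: sandwiched_def sandwiched_by_def)
    then have "inside p0 q0 (lift j (u (f a)) p q (y a)) (u (f a))"
      using iny[of a] ab by (intro inside_lift) auto
    then show ?case by (intro impI exI[of _ "\<lambda>_. lift j (u (f a)) p q (y a)"]) (simp add: orbit_def)
  next
    case (step i)
    show ?case
    proof
      assume b: "i + 1 \<le> b"
      then obtain x where x: "orbit p0 q0 u x (f a) (f i)" "x (f i) = lift j (u (f i)) p q (y i)"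
        using step by auto
      have lt: "f i < f (i + 1)" using f(1) by (simp add: strict_mono_less)
      have le: "f a \<le> f i" using f(1) step by (simp add: strict_mono_less_eq)
      define W where "W = map u [f i..f (i + 1)]"
      have ends: "hd W = u (f i)" "last W = u (f (i + 1))"
        "sum_list (map (disp p0 q0) (butlast W)) = (\<Sum>m\<in>{f i..<f (i + 1)}. disp p0 q0 (u m))"
        unfolding W_def by (rule map_upto_ends[OF lt])+
      have W: "W \<in> blocks (j div 2)" unfolding W_def
      proof (rule block_between_sandwiched[OF adm grp sf sf lt])
        show "\<not> sandwiched u m" if "f i < m" "m < f (i + 1)" for m
          by (rule enumeration_gap[OF f that])
      qed
      have y': "y (i + 1) = y i + disp p q (diagram_perm j (u (f i)))" using stepy step b by simp
      have run: "run p0 q0 (lift j (u (f i)) p q (y i)) W"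
        using run_block[OF W, of "y i"] iny[of i] iny[of "i + 1"] step b y' unfolding ends by simp
      \<comment> \<open>Positions inside the new block are partial sums of displacements, started at
        the lifted point where the orbit built so far ends.\<close>
      define z where "z m = lift j (u (f i)) p q (y i) + (\<Sum>l\<in>{f i..<m}. disp p0 q0 (u l))" for m
      have z: "inside p0 q0 (z m) (u m)" if "m \<in> {f i..f (i + 1)}" for m
        using run_inside[of p0 q0 _ u "f i" "f (i + 1)" m] run that unfolding W_def z_def by blast
      have z1: "z (m + 1) = z m + disp p0 q0 (u m)" if "f i \<le> m" for m
        using sum_int_last[OF that, of "\<lambda>l. disp p0 q0 (u l)"] by (simp add: z_def)
      have zi: "z (f i) = x (f i)" by (simp add: z_def x(2))
      define x' where "x' m = (if m \<le> f i then x m else z m)" for m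
      have xz: "x' m = z m" if "f i \<le> m" for m using that zi
          by (cases "m = f i") (auto simp: x'_def)
      have "orbit p0 q0 u x' (f a) (f (i + 1))"
        unfolding orbit_def
      proof (intro conjI ballI)
        fix m assume m: "m \<in> {f a..f (i + 1)}"
        show "inside p0 q0 (x' m) (u m)"
          using m x(1) z[of m] xz[of m] by (cases "m \<le> f i") (auto simp: x'_def orbit_def)
      next
        fix m assume m: "m \<in> {f a..<f (i + 1)}"
        show "x' (m + 1) = x' m + disp p0 q0 (u m)"
          using m x(1) z1[of m] xz[of m] xz[of "m + 1"]
              by (cases "m < f i") (auto simp: x'_def orbit_def)
      qed
      moreover have "x' (f (i + 1)) = lift j (u (f (i + 1))) p q (y (i + 1))"
        using lift_block[OF W, of "y i"] xz[of "f (i + 1)"] lt unfolding ends y'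
            by (simp add: z_def)
      ultimately show "\<exists>x. orbit p0 q0 u x (f a) (f (i + 1)) \<and>
          x (f (i + 1)) = lift j (u (f (i + 1))) p q (y (i + 1))" by blast
    qed
  qed
  then show ?thesis using ab by blast
qed

end

section \<open>Realizing alternating windows and extending finite orbits\<close>

lemma alternating_orbit:
  assumes adm: "admissible_0 u" and alt: "\<And>n. a < n \<Longrightarrow> n < b \<Longrightarrow> sandwiched u n"
  shows "\<exists>p q x. sector p q \<and> orbit p q u x a b"
proof -
  have "(u a, u (a + 1)) \<in> {(A, D), (D, A), (D, B), (B, D), (B, C), (C, B), (C, C)}"
    using adm unfolding admissible_0_def by blast
  moreover have r: "1 < sqrt 2" by simp
  \<comment> \<open>For \<open>q = 0\<close> the pairs \<open>A\<close>, \<open>D\<close> and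
    \<open>B\<close>, \<open>C\<close> are crossed by cylinders of period two, for
    \<open>p = 0\<close> the pairs \<open>D\<close>, \<open>B\<close> and \<open>C\<close>,
    \<open>C\<close>: the two displacements cancel. The witness for \<open>t\<close> is the midpoint
    of the interval of the first letter.\<close>
  ultimately have "\<exists>p q t. sector p q \<and> inside p q t (u a) \<and>
      inside p q (t + disp p q (u a)) (u (a + 1)) \<and>
      disp p q (u a) + disp p q (u (a + 1)) = 0"
    unfolding insert_iff empty_iff prod.inject simp_thms
  proof (elim disjE conjE)
    assume *: "u a = A" "u (a + 1) = D"
    show ?thesis
      unfolding * by (rule exI[of _ 1], rule exI[of _ 0], rule exI[of _ "1/2"])
        (simp add: sector_def pos_simps len_def; use r in \<open>intro conjI; linarith\<close>)
  next
    assume *: "u a = D" "u (a + 1) = A"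
    show ?thesis
      unfolding * by (rule exI[of _ 1], rule exI[of _ 0], rule exI[of _ "7/2 + 2 * sqrt 2"])
        (simp add: sector_def pos_simps len_def; use r in \<open>intro conjI; linarith\<close>)
  next
    assume *: "u a = D" "u (a + 1) = B"
    show ?thesis
      unfolding * by (rule exI[of _ 0], rule exI[of _ 1], rule exI[of _ "3/2 + sqrt 2"])
        (simp add: sector_def pos_simps len_def; use r in \<open>intro conjI; linarith\<close>)
  next
    assume *: "u a = B" "u (a + 1) = D"
    show ?thesis
      unfolding * by (rule exI[of _ 0], rule exI[of _ 1], rule exI[of _ "1/2"])
        (simp add: sector_def pos_simps len_def; use r in \<open>intro conjI; linarith\<close>)
  next
    assume *: "u a = B" "u (a + 1) = C"
    show ?thesis
      unfolding * by (rule exI[of _ 1], rule exI[of _ 0], rule exI[of _ "3/2 + sqrt 2 / 2"])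
        (simp add: sector_def pos_simps len_def; use r in \<open>intro conjI; linarith\<close>)
  next
    assume *: "u a = C" "u (a + 1) = B"
    show ?thesis
      unfolding * by (rule exI[of _ 1], rule exI[of _ 0], rule exI[of _ "5/2 + 3/2 * sqrt 2"])
        (simp add: sector_def pos_simps len_def; use r in \<open>intro conjI; linarith\<close>)
  next
    assume *: "u a = C" "u (a + 1) = C"
    show ?thesis
      unfolding * by (rule exI[of _ 0], rule exI[of _ 1], rule exI[of _ "1 + sqrt 2 / 2"])
        (simp add: sector_def pos_simps len_def; use r in \<open>intro conjI; linarith\<close>)
  qed
  then obtain p q t where t: "sector p q" "inside p q t (u a)"
      "inside p q (t + disp p q (u a)) (u (a + 1))"
    "disp p q (u a) + disp p q (u (a + 1)) = 0" by blast
  \<comment> \<open>Being sandwiched relates letters at distance two, so the induction carries two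
    consecutive letters.\<close>
  have per: "m \<le> b \<longrightarrow> u m = (if even (m - a) then u a else u (a + 1)) \<and>
      (m < b \<longrightarrow> u (m + 1) = (if even (m - a) then u (a + 1) else u a))" if "a \<le> m" for m
    using that
  proof (induction m rule: int_ge_induct)
    case (step m)
    have ev: "even (m + 1 - a) \<longleftrightarrow> odd (m - a)" by auto
    show ?case
    proof (intro impI conjI)
      assume b: "m + 1 \<le> b"
      then have IH: "u m = (if even (m - a) then u a else u (a + 1))"
        "u (m + 1) = (if even (m - a) then u (a + 1) else u a)" using step by simp_all
      then show "u (m + 1) = (if even (m + 1 - a) then u a else u (a + 1))" using ev by metis
      assume "m + 1 < b"
      then have "u m = u (m + 1 + 1)" using alt[of "m + 1"] step by (simp add: sandwiched_def)
      then show "u (m + 1 + 1) = (if even (m + 1 - a) then u (a + 1) else u a)" using IH(1) ev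
          by metis
    qed
  qed simp
  define x where "x m = (if even (m - a) then t else t + disp p q (u a))" for m
  have "orbit p q u x a b"
    unfolding orbit_def
  proof (intro conjI ballI)
    fix m assume m: "m \<in> {a..b}"
    then have "u m = (if even (m - a) then u a else u (a + 1))" using per[of m] by simp
    then show "inside p q (x m) (u m)" using t(2,3) by (simp add: x_def)
  next
    fix m assume m: "m \<in> {a..<b}"
    then have um: "u m = (if even (m - a) then u a else u (a + 1))" using per[of m] by simp
    have ev: "even (m + 1 - a) \<longleftrightarrow> odd (m - a)" by auto
    show "x (m + 1) = x m + disp p q (u m)" unfolding x_def ev um using t(4) by simp
  qed
  with t(1) show ?thesis by blast
qed

lemma inside_unique:
  assumes "sector p q" "inside p q t L" "inside p q t L'"
  shows "L = L'"
proof -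
  define P where "P = sqrt 2 * p"
  define Q where "Q = sqrt 2 * q"
  have "0 \<le> p" "0 \<le> q" "0 \<le> P" "0 \<le> Q" using assms(1) by (simp_all add: sector_def P_def Q_def)
  with assms(2,3) show ?thesis
    by (cases L; cases L'; simp add: pos_simps len_def flip: P_def Q_def)
qed

definition total :: "real \<Rightarrow> real \<Rightarrow> real" where
  "total p q = len p q A + len p q B + len p q C + len p q D"

lemma inside_range:
  assumes "sector p q" "inside p q t L"
  shows "0 < t" "t < total p q" "0 < t + disp p q L" "t + disp p q L < total p q"
proof -
  define P where "P = sqrt 2 * p"
  define Q where "Q = sqrt 2 * q"
  have "0 \<le> p" "0 \<le> q" "0 \<le> P" "0 \<le> Q" using assms(1) by (simp_all add: sector_def P_def Q_def)
  with assms(2) show "0 < t" "t < total p q" "0 < t + disp p q L" "t + disp p q L < total p q"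
    by (cases L; simp add: pos_simps len_def total_def flip: P_def Q_def)+
qed

text \<open>A window of an orbit stays valid under small translations, and all but countably many
  translates avoid the orbits of the endpoints, hence can be continued for ever.\<close>

lemma orbit_extends:
  assumes pq: "sector p q" and x: "orbit p q u x a b" and ab: "a \<le> b"
  shows "\<exists>v\<in>sector_codes. \<forall>i\<in>{a..b}. v i = u i"
proof -
  define Ends where "Ends = insert (total p q) (top_pos p q ` {A, B, C, D} \<union> bot_pos p q ` {A, B,
      C, D})"
  \<comment> \<open>The set \<open>E\<close> contains the endpoints translated by all integer
    combinations of displacements. It is countable and stable under steps in both directions, so an
    orbit that starts outside it never meets an endpoint.\<close>
  define E where "E = (\<lambda>(e, k1, k2, k3, k4). e + real_of_int k1 * disp p q A +
      real_of_int k2 * disp p q B +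
    real_of_int k3 * disp p q C + real_of_int k4 * disp p q D) ` (Ends \<times> UNIV \<times> UNIV \<times> UNIV \<times> UNIV)"
  have cE: "countable E" unfolding E_def Ends_def
    by (intro countable_image countable_SIGMA) (auto intro: countable_finite)
  have EndsE: "e \<in> E" if "e \<in> Ends" for e
    unfolding E_def using that by (intro image_eqI[of _ _ "(e, 0, 0, 0, 0)"]) auto
  have E_add: "t + disp p q L \<in> E" "t - disp p q L \<in> E" if tE: "t \<in> E" for t L
  proof -
    obtain z where z: "z \<in> Ends \<times> UNIV \<times> UNIV \<times> UNIV \<times> UNIV"
        "t = (\<lambda>(e, k1, k2, k3, k4). e + real_of_int k1 * disp p q A +
      real_of_int k2 * disp p q B + real_of_int k3 * disp p q C + real_of_int k4 * disp p q D) z"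
      using tE unfolding E_def by blast
    obtain e k1 k2 k3 k4 where "z = (e, k1, k2, k3, k4)" by (cases z) auto
    with z have e: "e \<in> Ends" "t = e + real_of_int k1 * disp p q A + real_of_int k2 * disp p q B +
      real_of_int k3 * disp p q C + real_of_int k4 * disp p q D" by auto
    have *: "e + real_of_int k1 * disp p q A + real_of_int k2 * disp p q B +
      real_of_int k3 * disp p q C + real_of_int k4 * disp p q D \<in> E" for k1 k2 k3 k4
      unfolding E_def using e(1) by (intro image_eqI[of _ _ "(e, k1, k2, k3, k4)"]) auto
    show "t + disp p q L \<in> E"
      using *[of "k1 + 1" k2 k3 k4] *[of k1 "k2 + 1" k3 k4] *[of k1 k2 "k3 +
          1" k4] *[of k1 k2 k3 "k4 + 1"]
      unfolding e(2) by (cases L) (simp_all add: algebra_simps)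
    show "t - disp p q L \<in> E"
      using *[of "k1 - 1" k2 k3 k4] *[of k1 "k2 - 1" k3 k4] *[of k1 k2 "k3 - 1" k4] *[of k1 k2 k3
          "k4 - 1"]
      unfolding e(2) by (cases L) (simp_all add: algebra_simps)
  qed
  define good where "good t \<longleftrightarrow> t \<notin> E \<and> 0 < t \<and> t < total p q" for t
  have ne: "t \<noteq> top_pos p q L" "t \<noteq> bot_pos p q L" if "good t" for t L
    using that EndsE[of "top_pos p q L"] EndsE[of "bot_pos p q L"] unfolding good_def Ends_def
    by (cases L; auto)+
  \<comment> \<open>The letter \<open>nl t\<close> codes the point \<open>t\<close> itself, while
    \<open>pl t\<close> is the letter whose interval has \<open>t\<close> in its image.\<close>
  define nl where "nl t = (SOME L. inside p q t L)" for t
  define pl where "pl t = (SOME L. inside p q (t - disp p q L) L)" for t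
  have nl: "inside p q t (nl t)" if "good t" for t
  proof -
    have "inside p q t A \<or> inside p q t B \<or> inside p q t C \<or> inside p q t D"
      using that ne(1)[OF that, of A] ne(1)[OF that, of B] ne(1)[OF that, of C] ne(1)[OF that, of D]
      unfolding inside_def good_def top_pos_def total_def letter.case by linarith
    then show ?thesis unfolding nl_def by (metis someI_ex)
  qed
  have pl: "inside p q (t - disp p q (pl t)) (pl t)" if "good t" for t
  proof -
    have "inside p q (t - disp p q A) A \<or> inside p q (t - disp p q B) B \<or>
        inside p q (t - disp p q C) C \<or> inside p q (t - disp p q D) D"
      using that ne(2)[OF that, of A] ne(2)[OF that, of B] ne(2)[OF that, of C] ne(2)[OF that, of D]
      unfolding inside_def good_def disp_def bot_pos_def total_def letter.case by linarith
    then show ?thesis unfolding pl_def by (metis (mono_tags, lifting) someI_ex)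
  qed
  define nx where "nx t = t + disp p q (nl t)" for t
  define pv where "pv t = t - disp p q (pl t)" for t
  have gnx: "good (nx t)" if "good t" for t
    using inside_range[OF pq nl[OF that]] that E_add(2)[of "nx t" "nl t"]
        by (auto simp: good_def nx_def)
  have gpv: "good (pv t)" if "good t" for t
    using inside_range[OF pq pl[OF that]] that E_add(1)[of "pv t" "pl t"]
        by (auto simp: good_def pv_def)
  have nxpv: "nx (pv t) = t" if "good t" for t
    using inside_unique[OF pq nl[OF gpv[OF that]], of "pl t"] pl[OF that]
        by (simp add: nx_def pv_def)
  \<comment> \<open>The smallest distance to a right endpoint over the window bounds the admissible
    translations to the right.\<close>
  obtain d where d: "0 < d" "\<And>i e. i \<in> {a..b} \<Longrightarrow> 0 \<le> e \<Longrightarrow> e < d \<Longrightarrow> inside p q (x i + e) (u i)"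
  proof
    define d where "d = Min ((\<lambda>i. top_pos p q (u i) + len p q (u i) - x i) ` {a..b})"
    have "d \<in> (\<lambda>i. top_pos p q (u i) + len p q (u i) - x i) ` {a..b}"
      unfolding d_def using ab by (intro Min_in) auto
    then show "0 < d" using x by (auto simp: orbit_def inside_def)
    fix i e assume i: "i \<in> {a..b}" and e: "0 \<le> e" "e < d"
    have "d \<le> top_pos p q (u i) + len p q (u i) - x i" unfolding d_def using i
        by (intro Min_le) auto
    moreover have "inside p q (x i) (u i)" using x i by (simp add: orbit_def)
    ultimately show "inside p q (x i + e) (u i)" using e by (simp add: inside_def)
  qed
  have "uncountable {x a<..<x a + d}" using uncountable_open_interval[of "x a" "x a + d"] d(1)
      by force
  then have "\<not> {x a<..<x a + d} \<subseteq> E" using cE countable_subset by metis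
  then obtain t0 where t0: "t0 \<in> {x a<..<x a + d}" "t0 \<notin> E" by (meson subsetI)
  define e where "e = t0 - x a"
  have e: "0 \<le> e" "e < d" using t0 by (auto simp: e_def)
  have good0: "good t0"
    using inside_range[OF pq d(2)[of a e]] e ab t0(2) by (auto simp: good_def e_def)
  define z where "z n = (if n \<ge> a then (nx ^^ nat (n - a)) t0 else (pv ^^ nat (a - n)) t0)" for n
  have gn: "good ((nx ^^ k) t0)" and gp: "good ((pv ^^ k) t0)" for k
    by (induction k) (use good0 gnx gpv in auto)
  have gz: "good (z n)" for n unfolding z_def using gn gp by simp
  have zs: "z (n + 1) = nx (z n)" for n
  proof (cases "n \<ge> a")
    case True
    then have "nat (n + 1 - a) = Suc (nat (n - a))" by simp
    with True show ?thesis unfolding z_def by simp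
  next
    case False
    then have "nat (a - n) = Suc (nat (a - (n + 1)))" by simp
    with False show ?thesis unfolding z_def using nxpv[OF gp] by auto
  qed
  have "code p q (\<lambda>n. nl (z n)) z" unfolding code_def using nl[OF gz] zs by (simp add: nx_def)
  then have mem: "(\<lambda>n. nl (z n)) \<in> sector_codes" using pq by (auto simp: sector_codes_def)
  have zx: "i \<le> b \<longrightarrow> z i = x i + e" if "a \<le> i" for i
    using that
  proof (induction i rule: int_ge_induct)
    case base
    show ?case by (simp add: z_def e_def)
  next
    case (step i)
    show ?case
    proof
      assume b: "i + 1 \<le> b"
      then have zi: "z i = x i + e" using step by simp
      have "nl (z i) = u i"
        using inside_unique[OF pq nl[OF gz[of i]], of "u i"] d(2)[of i e] e step b by (simp add: zi)
      moreover have "x (i + 1) = x i + disp p q (u i)" using x step b by (simp add: orbit_def)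
      ultimately show "z (i + 1) = x (i + 1) + e" unfolding zs nx_def zi by simp
    qed
  qed
  have "nl (z i) = u i" if i: "i \<in> {a..b}" for i
  proof -
    have zi: "z i = x i + e" using zx i by simp
    show ?thesis using inside_unique[OF pq nl[OF gz[of i]], of "u i"] d(2)[OF i e] unfolding zi .
  qed
  then show ?thesis using mem by (intro bexI[of _ "\<lambda>n. nl (z n)"]) auto
qed

section \<open>Geometry of the octagon\<close>

lemma inner_cis: "inner (cis a) (cis b) = cos (a - b)"
  by (simp add: inner_complex_def cos_diff)

lemma cis_decomposition:
  "z = inner (cis a) z *\<^sub>R cis a + inner (cis (a - pi / 2)) z *\<^sub>R cis (a - pi / 2)"
proof -
  have *: "x = x * (cos a * cos a) + x * (sin a * sin a)" for x :: real
    using sin_cos_squared_add3[of a] by (metis distrib_left mult.right_neutral)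
  show ?thesis
    using *[of "Re z"] *[of "Im z"]
    by (simp add: complex_eq_iff inner_complex_def cos_diff sin_diff algebra_simps)
qed

definition circumradius :: real where
  "circumradius = 1 / (2 * sin (pi / 8))"

definition apothem :: real where
  "apothem = circumradius * cos (pi / 8)"

text \<open>The outer unit normal of side \<open>k\<close>.\<close>

definition normal :: "nat \<Rightarrow> complex" where
  "normal k = cis (pi / 2 - (real k - 1) * pi / 4)"

text \<open>Two quantities coincide here: the speed of the direction towards side \<open>k\<close>
  (\<open>normal_direction\<close>) and the signed projected length of that side
  (\<open>shadow_step\<close>). Exits through side \<open>k\<close> require it to be
  positive.\<close>

definition slope :: "real \<Rightarrow> nat \<Rightarrow> real" where
  "slope \<theta> k = sin (\<theta> + (real k - 1) * pi / 4)"

text \<open>The projection of a vertex along the direction \<open>\<theta>\<close>, see \<open>inner_vertex\<close>.\<close>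

definition shadow :: "real \<Rightarrow> nat \<Rightarrow> real" where
  "shadow \<theta> k = circumradius * sin (\<theta> - 5 * pi / 8 + (real k - 1) * pi / 4)"

lemma sin_pi8: "0 < sin (pi / 8)" and cos_pi8: "0 < cos (pi / 8)"
  by (auto intro!: sin_gt_zero cos_gt_zero)

lemma circumradius_pos: "0 < circumradius"
  using sin_pi8 by (simp add: circumradius_def)

lemma apothem_pos: "0 < apothem"
  using circumradius_pos cos_pi8 by (simp add: apothem_def)

lemma vertex_alt: "vertex k = circumradius *\<^sub>R cis (5 * pi / 8 - (real k - 1) * pi / 4)"
  by (simp add: vertex_def circumradius_def)

lemma vertex_add_4: "vertex (k + 4) = - vertex k"
proof -
  define a where "a = 5 * pi / 8 - (real k - 1) * pi / 4"
  have "5 * pi / 8 - (real (k + 4) - 1) * pi / 4 = a - pi"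
    by (simp add: a_def field_simps)
  then show ?thesis unfolding vertex_alt a_def[symmetric]
      by (simp add: complex_eq_iff cos_diff sin_diff)
qed

lemma vertex_add_8: "vertex (k + 8) = vertex k"
  using vertex_add_4[of "k + 4"] vertex_add_4[of k] by (simp add: add.assoc)

lemma inner_vertex: "inner (cis (\<theta> - pi / 2)) (vertex k) = shadow \<theta> k"
proof -
  define \<phi> where "\<phi> = \<theta> - 5 * pi / 8 + (real k - 1) * pi / 4"
  have e: "\<theta> - pi / 2 - (5 * pi / 8 - (real k - 1) * pi / 4) = \<phi> - pi / 2"
    by (simp add: \<phi>_def)
  have "cos (\<phi> - pi / 2) = sin \<phi>" by (simp add: cos_diff)
  then show ?thesis unfolding vertex_alt inner_scaleR_right inner_cis e shadow_def
      \<phi>_def[symmetric] by simp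
qed

lemma inner_direction: "inner (cis (\<theta> - pi / 2)) (cis \<theta>) = 0"
  by (simp add: inner_cis)

lemma normal_direction: "inner (normal k) (cis \<theta>) = slope \<theta> k"
proof -
  define \<phi> where "\<phi> = \<theta> + (real k - 1) * pi / 4"
  have e: "pi / 2 - (real k - 1) * pi / 4 - \<theta> = pi / 2 - \<phi>" by (simp add: \<phi>_def)
  have "cos (pi / 2 - \<phi>) = sin \<phi>" by (simp add: cos_diff)
  then show ?thesis unfolding normal_def inner_cis e slope_def \<phi>_def[symmetric] by simp
qed

lemma normal_vertex: "inner (normal l) (vertex k) =
    circumradius * cos (pi / 8 + (real l - real k) * pi / 4)"
proof -
  have e: "pi / 2 - (real l - 1) * pi / 4 - (5 * pi / 8 - (real k - 1) * pi / 4) =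
      - (pi / 8 + (real l - real k) * pi / 4)"
    by (simp add: field_simps)
  show ?thesis unfolding vertex_alt normal_def inner_scaleR_right inner_cis e cos_minus by simp
qed

lemma normal_vertex_apothem: "inner (normal k) (vertex k) = apothem"
    "inner (normal k) (vertex (k + 1)) = apothem"
proof -
  have "pi / 8 + (real k - real (k + 1)) * pi / 4 = - (pi / 8)" by simp
  then show "inner (normal k) (vertex k) = apothem" "inner (normal k) (vertex (k + 1)) = apothem"
    unfolding normal_vertex apothem_def by simp_all
qed

lemma shadow_step: "shadow \<theta> (k + 1) - shadow \<theta> k = slope \<theta> k"
proof -
  define \<alpha> where "\<alpha> = \<theta> - pi / 2 + (real k - 1) * pi / 4"
  have e: "\<theta> - 5 * pi / 8 + (real (k + 1) - 1) * pi / 4 = \<alpha> + pi / 8"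
    "\<theta> - 5 * pi / 8 + (real k - 1) * pi / 4 = \<alpha> - pi / 8" "\<theta> + (real k - 1) * pi / 4 = pi / 2 + \<alpha>"
    by (simp_all add: \<alpha>_def field_simps)
  have "sin (\<alpha> + pi / 8) - sin (\<alpha> - pi / 8) = 2 * sin (pi / 8) * cos \<alpha>"
    by (simp only: sin_add sin_diff) simp
  moreover have "sin (pi / 2 + \<alpha>) = cos \<alpha>" by (simp add: sin_add)
  ultimately show ?thesis
    unfolding shadow_def slope_def e right_diff_distrib[symmetric] using sin_pi8
        by (simp add: circumradius_def)
qed

text \<open>An odd multiple of \<open>pi / 8\<close> stays at distance at least
  \<open>pi / 8\<close> from all multiples of \<open>2 * pi\<close>.\<close>

lemma cos_odd_le:
  fixes m :: int
  shows "cos (pi / 8 + of_int m * pi / 4) \<le> cos (pi / 8)"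
proof -
  define r where "r = m mod 8"
  define y where "y = pi / 8 + of_int r * pi / 4"
  have r: "0 \<le> r" "r \<le> 7" by (auto simp: r_def)
  have "m = 8 * (m div 8) + r" by (simp add: r_def)
  then have "real_of_int m = 8 * of_int (m div 8) + of_int r"
      by (metis of_int_add of_int_mult of_int_numeral)
  then have "pi / 8 + of_int m * pi / 4 = 2 * pi * of_int (m div 8) + y"
      by (simp add: y_def field_simps)
  then have c: "cos (pi / 8 + of_int m * pi / 4) = cos y" by (simp add: cos_add)
  have y: "pi / 8 \<le> y" "y \<le> 2 * pi - pi / 8"
    using r by (simp_all add: y_def field_simps)
  show ?thesis
  proof (cases "y \<le> pi")
    case True
    then show ?thesis unfolding c using y by (intro cos_monotone_0_pi_le) auto
  next
    case False
    have "cos y = cos (2 * pi - y)" by simp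
    also have "\<dots> \<le> cos (pi / 8)" using y False by (intro cos_monotone_0_pi_le) auto
    finally show ?thesis unfolding c .
  qed
qed

lemma normal_vertex_le: "inner (normal l) (vertex k) \<le> apothem"
proof -
  have "cos (pi / 8 + (real l - real k) * pi / 4) \<le> cos (pi / 8)"
    using cos_odd_le[of "int l - int k"] by simp
  then show ?thesis unfolding normal_vertex apothem_def using circumradius_pos by simp
qed

lemma vertex_in_octagon: "vertex k \<in> octagon"
proof -
  have "\<exists>i\<in>{1..8}. vertex k = vertex i"
  proof (induction k rule: less_induct)
    case (less k)
    consider "k = 0" | "k \<in> {1..8}" | "k > 8" by fastforce
    then show ?case
    proof cases
      case 1
      then show ?thesis using vertex_add_8[of 0] by (intro bexI[of _ 8]) auto
    next
      case 3
      then show ?thesis using less.IH[of "k - 8"] vertex_add_8[of "k - 8"] by auto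
    qed auto
  qed
  then show ?thesis unfolding octagon_def by (auto intro!: hull_inc)
qed

lemma octagon_convex: "convex octagon"
  by (simp add: octagon_def)

lemma normal_octagon_le: "z \<in> octagon \<Longrightarrow> inner (normal l) z \<le> apothem"
proof -
  have "octagon \<subseteq> {z. inner (normal l) z \<le> apothem}"
    unfolding octagon_def
    by (intro hull_minimal convex_halfspace_le) (auto simp: normal_vertex_le)
  then show "z \<in> octagon \<Longrightarrow> inner (normal l) z \<le> apothem" by blast
qed

lemma normal_interior_less:
  assumes "z \<in> interior octagon"
  shows "inner (normal l) z < apothem"
proof -
  have "normal l \<noteq> 0" by (simp add: normal_def)
  have "octagon \<subseteq> {z. inner (normal l) z \<le> apothem}" using normal_octagon_le by blast
  then have "interior octagon \<subseteq> {z. inner (normal l) z < apothem}"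
    using interior_mono interior_halfspace_le[OF \<open>normal l \<noteq> 0\<close>] by blast
  then show ?thesis using assms by blast
qed

section \<open>Trajectories and their projected codes\<close>

definition oct_code :: "real \<Rightarrow> (int \<Rightarrow> nat) \<Rightarrow> (int \<Rightarrow> real) \<Rightarrow> bool" where
  "oct_code \<theta> \<sigma> x \<longleftrightarrow> (\<forall>n. \<sigma> n \<in> {1..8} \<and> 0 < slope \<theta> (\<sigma> n) \<and>
     shadow \<theta> (\<sigma> n) < x n \<and> x n < shadow \<theta> (\<sigma> n + 1) \<and>
     x (n + 1) = x n + (shadow \<theta> (\<sigma> n + 5) - shadow \<theta> (\<sigma> n)))"

text \<open>Projecting the exit points along the direction removes the motion inside the octagon and
  leaves only the side translations. The translation at side \<open>k\<close> takes vertex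
  \<open>k\<close> to vertex \<open>k + 5\<close>, whence the index shift in
  \<open>oct_code\<close>.\<close>

lemma trajectory_oct_code:
  assumes "octagon_trajectory \<theta> \<tau> T \<sigma>"
  shows "\<exists>x. oct_code \<theta> \<sigma> x"
proof -
  have T: "strict_mono T" and \<sigma>: "\<And>n. \<sigma> n \<in> {1..8}"
    using assms unfolding octagon_trajectory_def by blast+
  obtain c where c: "0 < c" and run: "\<And>n. (\<forall>t\<in>{T n<..<T (n + 1)}.
           \<tau> t = \<tau> (T n) + (c * (t - T n)) *\<^sub>R cis \<theta> \<and> \<tau> t \<in> interior octagon) \<and>
        (\<exists>p\<in>open_side (\<sigma> (n + 1)).
           p = \<tau> (T n) + (c * (T (n + 1) - T n)) *\<^sub>R cis \<theta> \<and>
           \<tau> (T (n + 1)) = p + side_translation (\<sigma> (n + 1)))"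
    using assms unfolding octagon_trajectory_def by blast
  have int: "\<tau> t = \<tau> (T n) + (c * (t - T n)) *\<^sub>R cis \<theta> \<and> \<tau> t \<in> interior octagon"
    if "T n < t" "t < T (n + 1)" for n t
    by (intro bspec[OF conjunct1[OF run[of n]]]) (simp add: that)
  have hit: "\<exists>p\<in>open_side (\<sigma> (n + 1)). p = \<tau> (T n) + (c * (T (n + 1) - T n)) *\<^sub>R cis \<theta> \<and>
      \<tau> (T (n + 1)) = p + side_translation (\<sigma> (n + 1))" for n
    using run[of n] by blast
  have "\<exists>p. \<forall>n. p n \<in> open_side (\<sigma> n) \<and> p n = \<tau> (T (n - 1)) + (c * (T n - T (n - 1))) *\<^sub>R cis \<theta> \<and>
      \<tau> (T n) = p n + side_translation (\<sigma> n)"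
  proof (intro choice allI)
    fix n
    show "\<exists>p. p \<in> open_side (\<sigma> n) \<and> p = \<tau> (T (n - 1)) + (c * (T n - T (n - 1))) *\<^sub>R cis \<theta> \<and>
        \<tau> (T n) = p + side_translation (\<sigma> n)"
      using hit[of "n - 1"] unfolding diff_add_cancel by blast
  qed
  then obtain p where p': "\<forall>n. p n \<in> open_side (\<sigma> n) \<and>
      p n = \<tau> (T (n - 1)) + (c * (T n - T (n - 1))) *\<^sub>R cis \<theta> \<and>
      \<tau> (T n) = p n + side_translation (\<sigma> n)" by (rule exE)
  then have p: "p n \<in> open_side (\<sigma> n)" "p n = \<tau> (T (n - 1)) + (c * (T n - T (n - 1))) *\<^sub>R cis \<theta>"
    "\<tau> (T n) = p n + side_translation (\<sigma> n)" for n by blast+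
  \<comment> \<open>Halfway before the hit the point is interior and strictly below the line of the
    side; since it reaches that line later, the direction has a positive normal component.\<close>
  have pos: "0 < slope \<theta> (\<sigma> n)" for n
  proof -
    define t where "t = (T (n - 1) + T n) / 2"
    have "T (n - 1) < T n" using T by (simp add: strict_mono_less)
    then have t: "T (n - 1) < t" "t < T n" by (simp_all add: t_def)
    have i: "\<tau> t = \<tau> (T (n - 1)) + (c * (t - T (n - 1))) *\<^sub>R cis \<theta>" "\<tau> t \<in> interior octagon"
      using int[of "n - 1" t] t unfolding diff_add_cancel by blast+
    have "c * (T n - T (n - 1)) = c * (t - T (n - 1)) + c * (T n - t)" by (simp add: algebra_simps)
    then have "p n = \<tau> t + (c * (T n - t)) *\<^sub>R cis \<theta>"
      unfolding p(2)[of n] i(1) by (simp only: scaleR_add_left add.assoc)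
    moreover have "inner (normal (\<sigma> n)) (p n) = apothem"
    proof -
      obtain s where "p n = (1 - s) *\<^sub>R vertex (\<sigma> n) + s *\<^sub>R vertex (\<sigma> n + 1)"
        using p(1)[of n] unfolding open_side_def in_segment by blast
      then have "inner (normal (\<sigma> n)) (p n) = (1 - s) * apothem + s * apothem"
        by (simp only: inner_add_right inner_scaleR_right normal_vertex_apothem)
      then show ?thesis by (simp add: algebra_simps)
    qed
    ultimately have "0 < c * (T n - t) * slope \<theta> (\<sigma> n)"
      using normal_interior_less[OF i(2), of "\<sigma> n"] by (simp add: inner_add_right normal_direction)
    moreover have "0 < c * (T n - t)" using c t by simp
    ultimately show ?thesis using zero_less_mult_pos by blast
  qed
  define x where "x n = inner (cis (\<theta> - pi / 2)) (p n)" for n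
  have "shadow \<theta> (\<sigma> n) < x n \<and> x n < shadow \<theta> (\<sigma> n + 1)" for n
  proof -
    obtain s where s: "0 < s" "s < 1" "p n = (1 - s) *\<^sub>R vertex (\<sigma> n) + s *\<^sub>R vertex (\<sigma> n + 1)"
      using p(1)[of n] unfolding open_side_def in_segment by blast
    then have "x n = (1 - s) * shadow \<theta> (\<sigma> n) + s * shadow \<theta> (\<sigma> n + 1)"
      unfolding x_def s(3) by (simp only: inner_add_right inner_scaleR_right inner_vertex)
    then have "x n = shadow \<theta> (\<sigma> n) + s * slope \<theta> (\<sigma> n)"
        "x n = shadow \<theta> (\<sigma> n + 1) - (1 - s) * slope \<theta> (\<sigma> n)"
      unfolding shadow_step[symmetric] by (simp_all add: algebra_simps)
    moreover have "0 < s * slope \<theta> (\<sigma> n)" "0 < (1 - s) * slope \<theta> (\<sigma> n)" using s pos[of n]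
        by simp_all
    ultimately show ?thesis by linarith
  qed
  moreover have "x (n + 1) = x n + (shadow \<theta> (\<sigma> n + 5) - shadow \<theta> (\<sigma> n))" for n
    unfolding x_def p(2)[of "n + 1"] using p(3)[of n]
    by (simp add: inner_add_right inner_direction side_translation_def inner_diff_right
        inner_vertex)
  ultimately have "oct_code \<theta> \<sigma> x" unfolding oct_code_def using \<sigma> pos by blast
  then show ?thesis by blast
qed

text \<open>The chord runs inside the triangle spanned by the side and \<open>q\<close>, which is
  nondegenerate because \<open>q\<close> is off the line of the side; all three barycentric
  coordinates are positive.\<close>

lemma chord_interior:
  assumes E: "E = (1 - s) *\<^sub>R vertex k + s *\<^sub>R vertex (k + 1)" "0 < s" "s < 1"
    and q: "q \<in> octagon" "inner (normal k) q < apothem"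
    and z: "z = (1 - t) *\<^sub>R E + t *\<^sub>R q" "0 < t" "t < 1"
  shows "z \<in> interior octagon"
proof -
  have nc: "\<not> collinear {vertex k, q, vertex (k + 1)}"
  proof
    assume "collinear {vertex k, q, vertex (k + 1)}"
    moreover have "vertex k \<noteq> vertex (k + 1)"
    proof
      assume "vertex k = vertex (k + 1)"
      then have "shadow \<theta> (k + 1) = shadow \<theta> k" for \<theta> by (metis inner_vertex)
      then have "slope \<theta> k = 0" for \<theta> using shadow_step[of \<theta> k] by simp
      \<comment> \<open>In this direction, normal to the side, the slope is 1.\<close>
      from this[of "pi / 2 - (real k - 1) * pi / 4"] show False by (simp add: slope_def)
    qed
    ultimately obtain u where "q = u *\<^sub>R vertex k + (1 - u) *\<^sub>R vertex (k + 1)"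
      by (auto simp: collinear_3_expand)
    then have "inner (normal k) q = apothem"
      by (simp only: inner_add_right inner_scaleR_right normal_vertex_apothem) (simp add:
          algebra_simps)
    then show False using q(2) by simp
  qed
  have "z = ((1 - t) * (1 - s)) *\<^sub>R vertex k + t *\<^sub>R q + ((1 - t) * s) *\<^sub>R vertex (k + 1)"
    unfolding z(1) E(1) by (simp add: algebra_simps)
  moreover have "0 < (1 - t) * (1 - s)" "0 < (1 - t) * s" using E z by simp_all
  moreover have "(1 - t) * (1 - s) + t + (1 - t) * s = 1" by (simp add: algebra_simps)
  ultimately have "z \<in> interior (convex hull {vertex k, q, vertex (k + 1)})"
    unfolding interior_convex_hull_3_minimal[OF nc DIM_complex] mem_Collect_eq
    using z(2) by blast
  moreover have "convex hull {vertex k, q, vertex (k + 1)} \<subseteq> octagon"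
    using q(1) vertex_in_octagon octagon_convex by (intro hull_minimal) auto
  ultimately show ?thesis using interior_mono by blast
qed


lemma shadow_add_8: "shadow \<theta> (k + 8) = shadow \<theta> k"
  by (metis inner_vertex vertex_add_8)

lemma slope_add_8: "slope \<theta> (k + 8) = slope \<theta> k"
proof -
  have "shadow \<theta> (k + 8 + 1) = shadow \<theta> (k + 1)" using shadow_add_8[of \<theta> "k + 1"]
      by (simp add: ac_simps)
  then show ?thesis using shadow_step[of \<theta> "k + 8"] shadow_step[of \<theta> k] shadow_add_8[of \<theta> k] by simp
qed

lemma shadow_add_4: "shadow \<theta> (k + 4) = - shadow \<theta> k"
  by (simp add: vertex_add_4 flip: inner_vertex)

lemma slope_add_4: "slope \<theta> (k + 4) = - slope \<theta> k"
proof -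
  have "shadow \<theta> (k + 4 + 1) = - shadow \<theta> (k + 1)" using shadow_add_4[of \<theta> "k + 1"]
      by (simp add: ac_simps)
  then show ?thesis using shadow_step[of \<theta> "k + 4"] shadow_step[of \<theta> k] shadow_add_4[of \<theta> k] by simp
qed

lemma side_translation_alt: "side_translation k = - vertex (k + 1) - vertex k"
  using vertex_add_4[of "k + 1"] by (simp add: side_translation_def ac_simps)

text \<open>The translation to the opposite side is \<open>-2 * apothem\<close> times the outer
  normal of the side.\<close>

lemma side_translation_direction: "inner (cis \<theta>) (side_translation k) = - 2 * apothem * slope \<theta> k"
proof -
  define \<alpha> where "\<alpha> = \<theta> + (real k - 1) * pi / 4"
  have e: "\<theta> - (5 * pi / 8 - (real k - 1) * pi / 4) = \<alpha> - pi / 2 - pi / 8"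
    "\<theta> - (5 * pi / 8 - (real (k + 1) - 1) * pi / 4) = \<alpha> - pi / 2 + pi / 8"
    by (simp_all add: \<alpha>_def field_simps)
  have "cos (\<alpha> - pi / 2 - pi / 8) + cos (\<alpha> - pi / 2 + pi / 8) = 2 * cos (pi / 8) * cos (\<alpha> - pi / 2)"
    by (simp only: cos_add[of "\<alpha> - pi / 2"] cos_diff[of "\<alpha> - pi / 2"]) simp
  moreover have "cos (\<alpha> - pi / 2) = sin \<alpha>" by (simp add: cos_diff)
  moreover define c1 c2 where "c1 = cos (\<alpha> - pi / 2 - pi / 8)" "c2 = cos (\<alpha> - pi / 2 + pi / 8)"
  ultimately have "c1 + c2 = 2 * cos (pi / 8) * sin \<alpha>" by simp
  then have "circumradius * (c1 + c2) = circumradius * (2 * cos (pi / 8) * sin \<alpha>)" by (simp only:)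
  then show ?thesis
    unfolding side_translation_alt inner_diff_right inner_minus_right vertex_alt
        inner_scaleR_right inner_cis e
      apothem_def slope_def \<alpha>_def[symmetric] c1_c2_def[symmetric]
    by (simp add: algebra_simps)
qed

lemma int_between:
  fixes f :: "int \<Rightarrow> 'a::linorder"
  assumes "f l \<le> t" "t < f h" "l \<le> h"
  shows "\<exists>n. f n \<le> t \<and> t < f (n + 1)"
proof (rule ccontr)
  assume *: "\<not> ?thesis"
  have "f n \<le> t" if "l \<le> n" for n
    using that
  proof (induction n rule: int_ge_induct)
    case (step n)
    then show ?case using * by (meson not_less)
  qed (rule assms)
  from this[OF assms(3)] show False using assms(2) by simp
qed

text \<open>The re-entry point \<open>E\<close> is on side \<open>k + 4\<close> and the direction
  points inwards there, so a point of the octagon on the same line cannot lie behind it. If the two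
  points coincided, both ends of side \<open>k + 4\<close> would be on the line of side
  \<open>l\<close>; the sides would then be equal, contrary to the signs of the slopes.\<close>

lemma chord_positive:
  assumes E: "E = (1 - s) *\<^sub>R vertex (k + 5) + s *\<^sub>R vertex (k + 4)" "0 < s" "s < 1"
    and q: "q \<in> octagon" "inner (normal l) q = apothem"
    and r: "q = E + r *\<^sub>R cis \<theta>" and sl: "0 < slope \<theta> k" "0 < slope \<theta> l"
  shows "0 < r"
proof -
  have nE: "inner (normal m) E = (1 - s) * inner (normal m) (vertex (k + 5)) +
      s * inner (normal m) (vertex (k + 4))" for m
    unfolding E(1) by (simp add: inner_add_right)
  have "inner (normal (k + 4)) (vertex (k + 4)) = apothem"
      "inner (normal (k + 4)) (vertex (k + 5)) = apothem"
    using normal_vertex_apothem[of "k + 4"] by (simp_all add: ac_simps)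
  then have "inner (normal (k + 4)) E = apothem" unfolding nE by (simp add: algebra_simps)
  then have "r * slope \<theta> (k + 4) \<le> 0"
    using normal_octagon_le[OF q(1), of "k + 4"] unfolding r
        by (simp add: inner_add_right normal_direction)
  then have "0 \<le> r" using sl(1) unfolding slope_add_4 by (simp add: zero_le_mult_iff)
  moreover have "r \<noteq> 0"
  proof
    assume "r = 0"
    then have h: "inner (normal l) E = apothem" using q(2) r by simp
    define x where "x = inner (normal l) (vertex (k + 5))"
    define y where "y = inner (normal l) (vertex (k + 4))"
    have "x \<le> apothem" "y \<le> apothem" unfolding x_def y_def by (rule normal_vertex_le)+
    moreover have "(1 - s) * (apothem - x) + s * (apothem - y) = 0"
      using h unfolding nE x_def y_def by (simp add: algebra_simps)
    moreover have "0 \<le> (1 - s) * (apothem - x)" "0 \<le> s * (apothem - y)"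
      using E \<open>x \<le> apothem\<close> \<open>y \<le> apothem\<close> by simp_all
    ultimately have "(1 - s) * (apothem - x) = 0" "s * (apothem - y) = 0" by linarith+
    then have xy: "x = apothem" "y = apothem" using E by simp_all
    define \<beta> where "\<beta> = (real l - real (k + 4)) * pi / 4"
    have e: "pi / 8 + (real l - real (k + 5)) * pi / 4 = \<beta> - pi / 8"
        "pi / 8 + (real l - real (k + 4)) * pi / 4 = \<beta> + pi / 8"
      by (simp_all add: \<beta>_def field_simps)
    \<comment> \<open>Adding the two equations gives \<open>cos \<beta> = 1\<close>, that is, the
      indices \<open>l\<close> and \<open>k + 4\<close> agree modulo 8.\<close>
    have "cos (\<beta> - pi / 8) = cos (pi / 8)" "cos (\<beta> + pi / 8) = cos (pi / 8)"
      using xy circumradius_pos unfolding x_def y_def normal_vertex apothem_def e by simp_all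
    then have "cos \<beta> * cos (pi / 8) = cos (pi / 8)" unfolding cos_add cos_diff by linarith
    then have "cos \<beta> = 1" using cos_pi8 by simp
    then have "sin \<beta> = 0" using sin_cos_squared_add[of \<beta>] by simp
    define \<phi> where "\<phi> = \<theta> + (real (k + 4) - 1) * pi / 4"
    have "\<theta> + (real l - 1) * pi / 4 = \<phi> + \<beta>" by (simp add: \<beta>_def \<phi>_def field_simps)
    then have "slope \<theta> l = slope \<theta> (k + 4)"
      unfolding slope_def \<phi>_def[symmetric] by (simp add: sin_add \<open>cos \<beta> = 1\<close> \<open>sin \<beta> = 0\<close>)
    then show False using sl unfolding slope_add_4 by simp
  qed
  ultimately show ?thesis by simp
qed

text \<open>The projected positions determine the exit points on the sides. Re-entry and next exit
  point have the same projection, hence are joined by a chord in the given direction, and the chords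
  are traversed at unit speed.\<close>

lemma oct_code_trajectory:
  assumes x: "oct_code \<theta> \<sigma> x"
  shows "\<exists>\<tau> T. octagon_trajectory \<theta> \<tau> T \<sigma>"
proof -
  have \<sigma>: "\<sigma> n \<in> {1..8}" and sl: "0 < slope \<theta> (\<sigma> n)"
    and xb: "shadow \<theta> (\<sigma> n) < x n" "x n < shadow \<theta> (\<sigma> n + 1)"
    and xs: "x (n + 1) = x n + (shadow \<theta> (\<sigma> n + 5) - shadow \<theta> (\<sigma> n))" for n
    using x unfolding oct_code_def by blast+
  define s where "s n = (x n - shadow \<theta> (\<sigma> n)) / slope \<theta> (\<sigma> n)" for n
  have s: "0 < s n" "s n < 1" "s n * slope \<theta> (\<sigma> n) = x n - shadow \<theta> (\<sigma> n)" for n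
    using xb[of n] sl[of n] shadow_step[of \<theta> "\<sigma> n"] by (auto simp: s_def)
  define p where "p n = (1 - s n) *\<^sub>R vertex (\<sigma> n) + s n *\<^sub>R vertex (\<sigma> n + 1)" for n
  define E where "E n = p n + side_translation (\<sigma> n)" for n
  have v4: "vertex (k + 5) = - vertex (k + 1)" for k using vertex_add_4[of "k + 1"]
      by (simp add: ac_simps)
  \<comment> \<open>Opposite sides carry their vertices in reversed order, so the weights change
    places.\<close>
  have E: "E n = (1 - s n) *\<^sub>R vertex (\<sigma> n + 5) + s n *\<^sub>R vertex (\<sigma> n + 4)" for n
    unfolding E_def p_def side_translation_alt v4 vertex_add_4 by (simp add: algebra_simps)
  have pO: "p n \<in> octagon" for n
    unfolding p_def using s[of n] vertex_in_octagon octagon_convex by (intro convexD) auto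
  have side: "p n \<in> open_side (\<sigma> n)" for n
  proof -
    have "vertex (\<sigma> n) \<noteq> vertex (\<sigma> n + 1)"
      using sl[of n] shadow_step[of \<theta> "\<sigma> n"] by (metis diff_self inner_vertex less_irrefl)
    then show ?thesis unfolding open_side_def in_segment p_def using s[of n] by blast
  qed
  have px: "inner (cis (\<theta> - pi / 2)) (p n) = x n" for n
  proof -
    have "inner (cis (\<theta> - pi / 2)) (p n) = (1 - s n) * shadow \<theta> (\<sigma> n) + s n * shadow \<theta> (\<sigma> n + 1)"
      unfolding p_def by (simp only: inner_add_right inner_scaleR_right inner_vertex)
    also have "\<dots> = shadow \<theta> (\<sigma> n) + s n * slope \<theta> (\<sigma> n)"
      unfolding shadow_step[symmetric] by (simp add: algebra_simps)
    finally show ?thesis using s(3) by simp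
  qed
  have Ex: "inner (cis (\<theta> - pi / 2)) (E n) = x (n + 1)" for n
    unfolding E_def xs side_translation_def
        by (simp add: inner_add_right inner_diff_right px inner_vertex)
  define r where "r n = inner (cis \<theta>) (p (n + 1) - E n)" for n
  have pE: "p (n + 1) = E n + r n *\<^sub>R cis \<theta>" for n
  proof -
    have 0: "inner (cis (\<theta> - pi / 2)) (p (n + 1) - E n) = 0" by (simp only: inner_diff_right px Ex)
    have "p (n + 1) - E n = r n *\<^sub>R cis \<theta> +
        inner (cis (\<theta> - pi / 2)) (p (n + 1) - E n) *\<^sub>R cis (\<theta> - pi / 2)"
      unfolding r_def by (rule cis_decomposition)
    then have "p (n + 1) - E n = r n *\<^sub>R cis \<theta>" unfolding 0 by simp
    then show ?thesis by (metis add.commute diff_add_cancel)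
  qed
  have pn: "inner (normal (\<sigma> n)) (p n) = apothem" for n
    unfolding p_def by (simp only: inner_add_right inner_scaleR_right normal_vertex_apothem)
        (simp add: algebra_simps)
  have r: "0 < r n" for n
    by (rule chord_positive[OF E s(1,2) pO[of "n + 1"] pn pE sl sl])
  define g where "g n = 2 * apothem * slope \<theta> (\<sigma> n)" for n
  \<comment> \<open>The second sum makes the recursion \<open>G_step\<close> hold for negative
    indices as well, with value 0 at 0.\<close>
  define G where "G n = sum g {0..<n} - sum g {n..<0}" for n :: int
  have G_step: "G (n + 1) = G n + g n" for n
  proof (cases "0 \<le> n")
    case True
    then have "{0..<n + 1} = insert n {0..<n}" by auto
    with True show ?thesis by (simp add: G_def)
  next
    case False
    then have "{n..<0} = insert n {n + 1..<0}" by auto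
    with False show ?thesis by (simp add: G_def)
  qed
  \<comment> \<open>The identification at a side moves the trajectory backwards along \<open>\<theta>\<close>
      by \<open>g n\<close>, which is bounded
    below, so that the hitting times are unbounded in both directions.\<close>
  define T where "T n = inner (cis \<theta>) (p n) + G n" for n
  have T_step: "T (n + 1) = T n + r n" for n
    unfolding T_def G_step r_def E_def inner_diff_right inner_add_right
        side_translation_direction g_def by simp
  have T_less: "T m < T n" if "m < n" for m n
  proof -
    have "T m < T (m + 1 + int k)" for k
    proof (induction k)
      case 0
      show ?case using T_step[of m] r[of m] by simp
    next
      case (Suc k)
      then show ?case using T_step[of "m + 1 + int k"] r[of "m + 1 + int k"] by (simp add: ac_simps)
    qed
    from this[of "nat (n - m - 1)"] that show ?thesis by simp
  qed
  then have T_mono: "strict_mono T" by (simp add: strict_mono_def)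
  \<comment> \<open>Only finitely many positive slopes occur, so the jumps have a positive lower
    bound; the 1 keeps the set nonempty.\<close>
  define \<kappa> where "\<kappa> = Min (insert 1 ((\<lambda>k. 2 * apothem * slope \<theta> k) ` {k \<in> {1..8}. 0 < slope \<theta> k}))"
  have "\<kappa> \<in> insert 1 ((\<lambda>k. 2 * apothem * slope \<theta> k) ` {k \<in> {1..8}. 0 < slope \<theta> k})"
    unfolding \<kappa>_def by (intro Min_in) auto
  then have \<kappa>0: "0 < \<kappa>" using apothem_pos by auto
  have \<kappa>: "\<kappa> \<le> g n" for n
    unfolding \<kappa>_def g_def using \<sigma>[of n] sl[of n] by (intro Min_le) auto
  have G_up: "\<kappa> * of_int n \<le> G n" if "0 \<le> n" for n
    using that
  proof (induction n rule: int_ge_induct)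
    case (step n)
    then show ?case using G_step[of n] \<kappa>[of n] by (simp add: algebra_simps)
  qed (simp add: G_def)
  have G_down: "G n \<le> \<kappa> * of_int n" if "n \<le> 0" for n
    using that
  proof (induction n rule: int_le_induct)
    case (step n)
    then show ?case using G_step[of "n - 1"] \<kappa>[of "n - 1"] by (simp add: algebra_simps)
  qed (simp add: G_def)
  have "bounded octagon" unfolding octagon_def
      by (intro bounded_convex_hull finite_imp_bounded) simp
  then obtain B where B: "\<And>z. z \<in> octagon \<Longrightarrow> norm z \<le> B" by (auto simp: bounded_iff)
  have pB: "\<bar>inner (cis \<theta>) (p n)\<bar> \<le> B" for n
    using Cauchy_Schwarz_ineq2[of "cis \<theta>" "p n"] B[OF pO[of n]] by simp
  have cover: "\<exists>n. T n \<le> t \<and> t < T (n + 1)" for t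
  proof -
    \<comment> \<open>The times differ from \<open>G\<close> by at most the bound \<open>B\<close>
      of the octagon, so beyond this index they pass \<open>t\<close> on either side.\<close>
    obtain m :: nat where m: "(\<bar>t\<bar> + B + 1) / \<kappa> \<le> real m" using real_arch_simple by blast
    then have m': "\<bar>t\<bar> + B + 1 \<le> \<kappa> * real m" using \<kappa>0 by (simp add: field_simps)
    have "T (- int m) \<le> t" using G_down[of "- int m"] pB[of "- int m"] m' unfolding T_def by simp
    moreover have "t < T (int m)" using G_up[of "int m"] pB[of "int m"] m' unfolding T_def by simp
    ultimately show ?thesis by (rule int_between) simp
  qed
  define N where "N t = (THE n. T n \<le> t \<and> t < T (n + 1))" for t
  have N: "N t = n" if "T n \<le> t" "t < T (n + 1)" for t n
    unfolding N_def
  proof (rule the_equality)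
    show "T n \<le> t \<and> t < T (n + 1)" using that by simp
    fix m assume m: "T m \<le> t \<and> t < T (m + 1)"
    show "m = n"
    proof (rule ccontr)
      assume "m \<noteq> n"
      then have "m + 1 \<le> n \<or> n + 1 \<le> m" by linarith
      then have "T (m + 1) \<le> T n \<or> T (n + 1) \<le> T m" using T_mono by (simp add: strict_mono_less_eq)
      then show False using m that by linarith
    qed
  qed
  define \<tau> where "\<tau> t = E (N t) + (t - T (N t)) *\<^sub>R cis \<theta>" for t
  have \<tau>: "\<tau> t = E n + (t - T n) *\<^sub>R cis \<theta>" if "T n \<le> t" "t < T (n + 1)" for t n
    unfolding \<tau>_def N[OF that] ..
  have \<tau>T: "\<tau> (T n) = E n" for n using \<tau>[of n "T n"] T_less[of n "n + 1"] by simp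
  have inside: "E n + (t - T n) *\<^sub>R cis \<theta> \<in> interior octagon"
      if t: "T n < t" "t < T (n + 1)" for n t
  \<comment> \<open>The chord starts on side \<open>\<sigma> n + 4\<close>, on which the parameter
    is \<open>1 - s n\<close> because of the reversed order.\<close>
  proof (rule chord_interior)
    show "E n = (1 - (1 - s n)) *\<^sub>R vertex (\<sigma> n + 4) + (1 - s n) *\<^sub>R vertex (\<sigma> n + 4 + 1)"
      unfolding E by (simp add: ac_simps)
    show "0 < 1 - s n" "1 - s n < 1" using s[of n] by simp_all
    show "p (n + 1) \<in> octagon" by (rule pO)
    have "inner (normal (\<sigma> n + 4)) (E n) = apothem"
    proof -
      have "inner (normal (\<sigma> n + 4)) (vertex (\<sigma> n + 4)) = apothem"
          "inner (normal (\<sigma> n + 4)) (vertex (\<sigma> n + 5)) = apothem"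
        using normal_vertex_apothem[of "\<sigma> n + 4"] by (simp_all add: ac_simps)
      then show ?thesis unfolding E by (simp add: inner_add_right algebra_simps)
    qed
    moreover have "0 < r n * slope \<theta> (\<sigma> n)" using r sl by simp
    ultimately show "inner (normal (\<sigma> n + 4)) (p (n + 1)) < apothem"
      unfolding pE by (simp add: inner_add_right normal_direction slope_add_4)
    define l where "l = (t - T n) / r n"
    have l: "l * r n = t - T n" using r[of n] by (simp add: l_def)
    show "E n + (t - T n) *\<^sub>R cis \<theta> = (1 - l) *\<^sub>R E n + l *\<^sub>R p (n + 1)"
      unfolding pE by (simp add: algebra_simps flip: l)
    show "0 < l" "l < 1" using t T_step[of n] r[of n] by (simp_all add: l_def)
  qed
  have "octagon_trajectory \<theta> \<tau> T \<sigma>"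
    unfolding octagon_trajectory_def
  proof (intro conjI)
    show "strict_mono T" by (rule T_mono)
    show "\<forall>t. \<exists>n. T n \<le> t \<and> t < T (n + 1)" using cover by blast
    show "\<forall>n. \<sigma> n \<in> {1..8}" using \<sigma> by blast
    show "\<exists>c>0. \<forall>n. (\<forall>t\<in>{T n<..<T (n + 1)}.
           \<tau> t = \<tau> (T n) + (c * (t - T n)) *\<^sub>R cis \<theta> \<and> \<tau> t \<in> interior octagon) \<and>
        (\<exists>p\<in>open_side (\<sigma> (n + 1)). p = \<tau> (T n) + (c * (T (n + 1) - T n)) *\<^sub>R cis \<theta> \<and>
           \<tau> (T (n + 1)) = p + side_translation (\<sigma> (n + 1)))"
    proof (intro exI[of _ 1] conjI allI ballI)
      show "(0::real) < 1" by simp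
      fix n
      show "\<tau> t = \<tau> (T n) + (1 * (t - T n)) *\<^sub>R cis \<theta>" "\<tau> t \<in> interior octagon"
          if "t \<in> {T n<..<T (n + 1)}" for t
        using that \<tau>[of n t] inside[of n t] by (simp_all add: \<tau>T)
      show "\<exists>q\<in>open_side (\<sigma> (n + 1)). q = \<tau> (T n) + (1 * (T (n + 1) - T n)) *\<^sub>R cis \<theta> \<and>
          \<tau> (T (n + 1)) = q + side_translation (\<sigma> (n + 1))"
      proof (intro bexI[of _ "p (n + 1)"] conjI)
        show "p (n + 1) = \<tau> (T n) + (1 * (T (n + 1) - T n)) *\<^sub>R cis \<theta>"
          unfolding \<tau>T T_step pE by simp
        show "\<tau> (T (n + 1)) = p (n + 1) + side_translation (\<sigma> (n + 1))" unfolding \<tau>T E_def ..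
      qed (rule side)
    qed
  qed
  then show ?thesis by blast
qed

section \<open>Infinitely coherent words\<close>

lemma diagram_index_cases:
  assumes "i \<le> (7::nat)"
  obtains "i = 0" | "i = 1" | "i = 2" | "i = 3" | "i = 4" | "i = 5" | "i = 6" | "i = 7"
proof -
  have "i \<in> {0, 1, 2, 3, 4, 5, 6, 7}" using assms by auto
  with that show thesis by blast
qed

text \<open>The eight permutations form the dihedral group of order 8, the action of the symmetries
  of the octagon on labels.\<close>

lemma diagram_perm_comp:
  assumes "i \<le> 7" "j \<le> 7"
  shows "\<exists>l\<le>7. diagram_perm i \<circ> diagram_perm j = diagram_perm l"
proof -
  have "\<exists>l\<in>{0, 1, 2, 3, 4, 5, 6, 7}. \<forall>L\<in>{A, B, C, D}. diagram_perm i (diagram_perm j L) =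
      diagram_perm l L"
    by (cases rule: diagram_index_cases[OF assms(1)]; cases rule: diagram_index_cases[OF assms(2)];
      simp only: diagram_perm_simps id_apply bex_simps ball_simps letter.distinct simp_thms)
  then obtain l where l: "l \<in> {0, 1, 2, 3, 4, 5, 6, 7}"
    "\<forall>L\<in>{A, B, C, D}. diagram_perm i (diagram_perm j L) = diagram_perm l L" by blast
  have "diagram_perm i (diagram_perm j L) = diagram_perm l L" for L
    using l(2) by (cases L) blast+
  then have "diagram_perm i \<circ> diagram_perm j = diagram_perm l" by (simp add: fun_eq_iff)
  moreover have "l \<le> 7" using l(1) by auto
  ultimately show ?thesis by blast
qed

lemma finite_letters: "finite (UNIV :: letter set)"
proof -
  have "(UNIV :: letter set) = {A, B, C, D}" using letter.exhaust by blast
  moreover have "finite {A, B, C, D}" by simp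
  ultimately show ?thesis by (simp only:)
qed

lemma bij_diagram_perm:
  assumes "i \<le> 7"
  shows "bij (diagram_perm i)"
  using inj_diagram_perm[of i] finite_UNIV_inj_surj[OF finite_letters] assms by (auto simp: bij_def)

lemma admissible_recode:
  assumes "i \<le> 7"
  shows "admissible (diagram_perm i \<circ> w) \<Longrightarrow> admissible w"
proof -
  assume "admissible (diagram_perm i \<circ> w)"
  then obtain l where l: "l \<le> 7" "admissible_0 (diagram_perm l \<circ> (diagram_perm i \<circ> w))"
    by (auto simp: admissible_def admissible_in_def)
  obtain m where "m \<le> 7" "diagram_perm l \<circ> diagram_perm i = diagram_perm m"
    using diagram_perm_comp[OF l(1) assms] by blast
  with l(2) have "admissible_in m w" by (simp add: admissible_in_def flip: comp_assoc)
  then show "admissible w" by (auto simp: admissible_def)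
qed

lemma derivable_recode:
  assumes "i \<le> 7" "derivable (diagram_perm i \<circ> w)"
  shows "derivable w"
  using assms admissible_recode inj_diagram_perm[of i] by (auto simp: derivable_def derived_comp)

lemma sector_codes_shift:
  assumes "v \<in> sector_codes"
  shows "(\<lambda>n. v (n + s)) \<in> sector_codes"
proof -
  obtain p q x where "sector p q" "code p q v x" using assms by (auto simp: sector_codes_def)
  then have "code p q (\<lambda>n. v (n + s)) (\<lambda>n. x (n + s))"
    unfolding code_def by (metis add.assoc add.commute)
  with \<open>sector p q\<close> show ?thesis by (auto simp: sector_codes_def)
qed

text \<open>One level of coherence, with all further levels replaced by the requirement that the
  renormalized derived word is a code of the first sector.\<close>

definition coherent_words :: "nat \<Rightarrow> bi_word set" where
  "coherent_words j = {u. admissible_0 u \<and>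
     (\<forall>n L. sandwiched_by L u n \<longrightarrow> (L, u n) \<in> sandwich_group (j div 2)) \<and>
     diagram_perm j \<circ> derived u \<in> sector_codes}"

lemma sector_codes_coherent: "sector_codes \<subseteq> (\<Union>j\<in>{1..7}. coherent_words j)"
proof
  fix u assume "u \<in> sector_codes"
  then obtain p0 q0 x where x: "sector p0 q0" "code p0 q0 u x" by (auto simp: sector_codes_def)
  obtain j p q where "child j p q p0 q0" using exists_child[OF x(1)] by blast
  then interpret child j p q p0 q0 .
  have "u \<in> coherent_words j"
    using code_child[OF x(2)] sector by (auto simp: coherent_words_def sector_codes_def)
  then show "u \<in> (\<Union>j\<in>{1..7}. coherent_words j)" using index by blast
qed

text \<open>Admissibility and the group condition concern at most three consecutive letters, so they
  pass to limits; the last condition does so by continuity of derivation and recoding.\<close>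

lemma window_closure_coherent:
  assumes u: "u \<in> window_closure (coherent_words j)" and j: "j \<le> 7"
  shows "admissible_0 u" and "\<And>n L. sandwiched_by L u n \<Longrightarrow> (L, u n) \<in> sandwich_group (j div 2)"
    and "diagram_perm j \<circ> derived u \<in> window_closure sector_codes"
proof -
  have "(u n, u (n + 1)) \<in> {(A, D), (D, A), (D, B), (B, D), (B, C), (C, B), (C, C)}" for n
  proof -
    obtain v where v: "v \<in> coherent_words j" "\<And>m. \<bar>m\<bar> \<le> \<bar>n\<bar> + 1 \<Longrightarrow> v m = u m"
      by (rule window_closureE[OF u, where N = "\<bar>n\<bar> + 1"]) blast
    have "v n = u n" "v (n + 1) = u (n + 1)" by (intro v(2); linarith)+
    moreover have "admissible_0 v" using v(1) by (simp add: coherent_words_def)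
    ultimately show ?thesis unfolding admissible_0_def by metis
  qed
  then show adm: "admissible_0 u" unfolding admissible_0_def by blast
  show "(L, u n) \<in> sandwich_group (j div 2)" if "sandwiched_by L u n" for n L
  proof -
    obtain v where v: "v \<in> coherent_words j" "\<And>m. \<bar>m\<bar> \<le> \<bar>n\<bar> + 1 \<Longrightarrow> v m = u m"
      by (rule window_closureE[OF u, where N = "\<bar>n\<bar> + 1"]) blast
    have e: "v (n - 1) = u (n - 1)" "v n = u n" "v (n + 1) = u (n + 1)" by (intro v(2); linarith)+
    then have sv: "sandwiched_by L v n" using that by (simp add: sandwiched_by_def)
    have "\<forall>n L. sandwiched_by L v n \<longrightarrow> (L, v n) \<in> sandwich_group (j div 2)"
      using v(1) unfolding coherent_words_def by blast
    then have "(L, v n) \<in> sandwich_group (j div 2)" using sv by blast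
    then show ?thesis unfolding e(2) .
  qed
  have "derived u \<in> window_closure {w. diagram_perm j \<circ> w \<in> sector_codes}"
  proof (rule derived_window_closure[OF u admissible_0_admissible[OF adm]])
    show "admissible v \<and> derived v \<in> {w. diagram_perm j \<circ> w \<in> sector_codes}"
        if "v \<in> coherent_words j" for v
      using that by (simp add: coherent_words_def admissible_0_admissible)
    show "(\<lambda>n. v (n + s)) \<in> {w. diagram_perm j \<circ> w \<in> sector_codes}"
      if "v \<in> {w. diagram_perm j \<circ> w \<in> sector_codes}" for v s
      using sector_codes_shift[of "diagram_perm j \<circ> v" s] that by (simp add: comp_def)
  qed
  then show "diagram_perm j \<circ> derived u \<in> window_closure sector_codes"
    unfolding window_closure_recode[OF bij_diagram_perm[OF j]] by simp
qed

lemma closure_coherent: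
  assumes u: "u \<in> window_closure sector_codes"
  shows "\<exists>j\<in>{1..7}. u \<in> window_closure (coherent_words j)"
proof -
  have "u \<in> window_closure (\<Union>j\<in>{1..7}. coherent_words j)"
    using u window_closure_mono[OF sector_codes_coherent] by blast
  then show ?thesis unfolding window_closure_UN[OF finite_atLeastAtMost] by simp
qed

lemma closure_step:
  assumes i: "i \<le> 7" and w: "diagram_perm i \<circ> w \<in> window_closure sector_codes"
  shows "\<exists>j\<in>{1..7}. coherent i j w \<and>
    diagram_perm j \<circ> derived (diagram_perm i \<circ> w) \<in> window_closure sector_codes"
proof -
  define u where "u = diagram_perm i \<circ> w"
  obtain j where j: "j \<in> {1..7}" "u \<in> window_closure (coherent_words j)"
    using closure_coherent w unfolding u_def by blast
  then have j7: "j \<le> 7" by simp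
  note c = window_closure_coherent[OF j(2) j7]
  have adm': "admissible_0 (diagram_perm j \<circ> derived u)"
    using closure_coherent[OF c(3)] window_closure_coherent(1) by fastforce
  have "derivable u" unfolding derivable_def
    using admissible_0_admissible[OF c(1)] admissible_recode[OF j7 admissible_0_admissible[OF
        adm']] by blast
  then have "derivable w" using derivable_recode[OF i] unfolding u_def by blast
  moreover have "admissible_in i w" using c(1) i unfolding admissible_in_def u_def by simp
  moreover have "admissible_in j (derived u)" using adm' j(1) unfolding admissible_in_def by simp
  moreover have "j div 2 \<in> {0..3}" using j(1) by auto
  ultimately have "coherent i j w"
    unfolding coherent_def Let_def u_def[symmetric] using c(2) j(1) by blast
  then show ?thesis using j(1) c(3) unfolding u_def by blast
qed

lemma closure_infinitely_coherent:
  assumes i: "i \<le> 7" and w: "diagram_perm i \<circ> w \<in> window_closure sector_codes"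
  shows "infinitely_coherent w"
proof -
  \<comment> \<open>The state at stage \<open>n\<close> is the pair of the index and the
    renormalized word; index 0 is allowed only at the start, as in \<open>S_star\<close>.\<close>
  define P where "P n z \<longleftrightarrow> fst z \<le> 7 \<and> (1 \<le> n \<longrightarrow> 1 \<le> fst z) \<and> (n = 0 \<longrightarrow> snd z = w) \<and>
    diagram_perm (fst z) \<circ> snd z \<in> window_closure sector_codes" for n :: nat
        and z :: "nat \<times> bi_word"
  define R where "R n y z \<longleftrightarrow> coherent (fst y) (fst z) (snd y) \<and>
    snd z = derived (diagram_perm (fst y) \<circ> snd y)" for n :: nat and y z :: "nat \<times> bi_word"
  have "\<exists>F. \<forall>n. P n (F n) \<and> R n (F n) (F (Suc n))"
  proof (rule dependent_nat_choice)
    show "\<exists>z. P 0 z" using i w by (intro exI[of _ "(i, w)"]) (simp add: P_def)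
    show "\<exists>z. P (Suc n) z \<and> R n y z" if Pn: "P n y" for n y
    proof -
      obtain j where "j \<in> {1..7}" "coherent (fst y) j (snd y)"
        "diagram_perm j \<circ> derived (diagram_perm (fst y) \<circ> snd y) \<in> window_closure sector_codes"
        using closure_step[of "fst y" "snd y"] Pn unfolding P_def by blast
      then show ?thesis
        by (intro exI[of _ "(j, derived (diagram_perm (fst y) \<circ> snd y))"]) (simp add: P_def R_def)
    qed
  qed
  then obtain F where F: "\<And>n. P n (F n)" "\<And>n. R n (F n) (F (Suc n))" by blast
  define s where "s n = fst (F n)" for n
  have ren: "renormalized s w n = snd (F n)" for n
  proof (induction n)
    case 0
    show ?case using F(1)[of 0] by (simp add: P_def)
  next
    case (Suc n)
    then show ?case using F(2)[of n] by (simp add: R_def s_def)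
  qed
  have s7: "s n \<le> 7" for n using F(1)[of n] by (simp add: P_def s_def)
  have coh: "coherent (s n) (s (Suc n)) (renormalized s w n)" for n
    using F(2)[of n] by (simp add: R_def s_def ren)
  \<comment> \<open>Infinite derivability concerns derived words without recoding; these differ from
    the renormalized ones by a permutation from the group.\<close>
  have "\<exists>l\<le>7. renormalized s w n = diagram_perm l \<circ> (derived ^^ n) w" for n
  proof (induction n)
    case 0
    show ?case by (intro exI[of _ 0]) (simp add: diagram_perm_simps)
  next
    case (Suc n)
    then obtain l where l: "l \<le> 7" "renormalized s w n = diagram_perm l \<circ> (derived ^^ n) w" by blast
    obtain m where m: "m \<le> 7" "diagram_perm (s n) \<circ> diagram_perm l = diagram_perm m"
      using diagram_perm_comp[OF s7 l(1)] by blast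
    have "renormalized s w (Suc n) = derived (diagram_perm m \<circ> (derived ^^ n) w)"
      by (simp add: l(2) m(2) flip: comp_assoc)
    also have "\<dots> = diagram_perm m \<circ> (derived ^^ Suc n) w"
      using inj_diagram_perm[of m] m(1) by (simp add: derived_comp)
    finally show ?case using m(1) by blast
  qed
  then have "derivable ((derived ^^ n) w)" for n
    using coh[of n] derivable_recode unfolding coherent_def by metis
  then have "infinitely_coherent_wrt s w"
    unfolding infinitely_coherent_wrt_def infinitely_derivable_def using coh by blast
  moreover have "s \<in> S_star"
    unfolding S_star_def using F(1) s7 by (auto simp: P_def s_def)
  ultimately show ?thesis unfolding infinitely_coherent_def by blast
qed

section \<open>From infinitely coherent words to orbits\<close>

lemma strict_mono_int_growth:
  fixes f :: "int \<Rightarrow> int"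
  assumes "strict_mono f" "i \<le> k"
  shows "f i + (k - i) \<le> f k"
  using assms(2)
proof (induction k rule: int_ge_induct)
  case (step k)
  have "f k < f (k + 1)" using assms(1) by (simp add: strict_mono_less)
  with step show ?case by simp
qed simp

lemma strict_mono_int_between:
  fixes f :: "int \<Rightarrow> int"
  assumes "strict_mono f"
  shows "\<exists>n. f n \<le> t \<and> t < f (n + 1)"
proof (rule int_between)
  define k where "k = \<bar>t - f 0\<bar> + 1"
  have k: "- k \<le> 0" "0 \<le> k" by (simp_all add: k_def)
  show "f (- k) \<le> t" "t < f k"
    using strict_mono_int_growth[OF assms k(1)] strict_mono_int_growth[OF assms k(2)]
        unfolding k_def by linarith+
  show "- k \<le> k" using k by simp
qed

text \<open>Induction on the length of the window, with the level \<open>k\<close> free: a window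
  that is not alternating is generated from a shorter window one level up.\<close>

lemma coherent_orbits:
  fixes v :: "nat \<Rightarrow> bi_word"
  assumes adm: "\<And>k. admissible_0 (v k)" and j: "\<And>k. j k \<in> {1..7}"
    and grp: "\<And>k n L. sandwiched_by L (v k) n \<Longrightarrow> (L, v k n) \<in> sandwich_group (j k div 2)"
    and step: "\<And>k. v (Suc k) = diagram_perm (j k) \<circ> derived (v k)"
    and ab: "a \<le> b"
  shows "\<exists>p q x. sector p q \<and> orbit p q (v k) x a b"
  using ab
proof (induction "nat (b - a)" arbitrary: a b k rule: less_induct)
  case less
  show ?case
  proof (cases "\<forall>n. a < n \<longrightarrow> n < b \<longrightarrow> sandwiched (v k) n")
    case True
    then show ?thesis using alternating_orbit[OF adm[of k], of a b] by blast
  next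
    case False
    then obtain m where m: "a < m" "m < b" "\<not> sandwiched (v k) m" by blast
    obtain f where f: "strict_mono f" "range f = {n. sandwiched (v k) n}" "derived (v k) = v k \<circ> f"
      by (rule derived_enumeration[OF admissible_0_admissible[OF adm]])
    \<comment> \<open>The indices \<open>c\<close> and \<open>d + 1\<close> mark the closest
      sandwiched positions with \<open>f c \<le> a\<close> and \<open>b \<le> f (d + 1)\<close>, so
      these blocks cover the window.\<close>
    obtain c where c: "f c \<le> a" "a < f (c + 1)" using strict_mono_int_between[OF f(1)] by blast
    obtain d where d: "f d \<le> b - 1" "b - 1 < f (d + 1)" using strict_mono_int_between[OF f(1)]
        by blast
    have "f c < f (d + 1)" using c d m by linarith
    then have cd: "c \<le> d" using f(1) by (simp add: strict_mono_less)
    \<comment> \<open>The \<open>d - c\<close> sandwiched positions strictly inside the window avoid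
      \<open>m\<close>, so there are at most \<open>b - a - 2\<close> of them and the window
      \<open>{c..d + 1}\<close> is strictly shorter.\<close>
    have "f ` {c + 1..d} \<subseteq> {a + 1..b - 1} - {m}"
    proof
      fix y assume "y \<in> f ` {c + 1..d}"
      then obtain i where i: "c + 1 \<le> i" "i \<le> d" "y = f i" by auto
      then have "f (c + 1) \<le> y" "y \<le> f d" using f(1) by (simp_all add: strict_mono_less_eq)
      moreover have "sandwiched (v k) y" using f(2) i(3) by blast
      ultimately show "y \<in> {a + 1..b - 1} - {m}" using c d m by auto
    qed
    then have "card (f ` {c + 1..d}) \<le> card ({a + 1..b - 1} - {m})" by (intro card_mono) auto
    also have "\<dots> = nat (b - 1 - a) - 1" using m by (subst card_Diff_singleton) auto
    finally have "nat (d - c) \<le> nat (b - 1 - a) - 1"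
      using strict_mono_on_imp_inj_on[of UNIV f] f(1)
          by (simp add: card_image inj_on_subset strict_mono_imp_increasing)
    then have "nat (d + 1 - c) < nat (b - a)" using m cd by linarith
    then obtain p q y where y: "sector p q" "orbit p q (v (Suc k)) y c (d + 1)"
      using less.hyps[of "d + 1" c "Suc k"] cd by auto
    define p0 where "p0 = fst (parent (j k) p q)"
    define q0 where "q0 = snd (parent (j k) p q)"
    interpret child "j k" p q p0 q0 using j y(1) by unfold_locales (simp_all add: p0_def q0_def)
    have "orbit p q (diagram_perm (j k) \<circ> v k \<circ> f) y c (d + 1)"
      using y(2) by (simp add: step f(3) comp_assoc)
    then obtain x where "orbit p0 q0 (v k) x (f c) (f (d + 1))"
      using orbit_parent[OF adm grp f(1,2)] cd by force
    then have "orbit p0 q0 (v k) x a b" using c d by (auto simp: orbit_def)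
    then show ?thesis using sector_parent by blast
  qed
qed

lemma infinitely_coherent_closure:
  assumes "infinitely_coherent w"
  shows "\<exists>i\<le>7. diagram_perm i \<circ> w \<in> window_closure sector_codes"
proof -
  obtain s where s: "s \<in> S_star" "\<And>k. coherent (s k) (s (Suc k)) (renormalized s w k)"
    using assms unfolding infinitely_coherent_def infinitely_coherent_wrt_def by blast
  \<comment> \<open>These are the normalized words of the coherence conditions; the group for level
    \<open>k\<close> comes from the next index \<open>s (Suc k)\<close>.\<close>
  define v where "v k = diagram_perm (s k) \<circ> renormalized s w k" for k
  have orb: "\<exists>p q x. sector p q \<and> orbit p q (v 0) x (- N) N" if "0 \<le> N" for N
  proof (rule coherent_orbits[of v "\<lambda>k. s (Suc k)"])
    show "admissible_0 (v k)" for k using s(2)[of k]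
        by (simp add: coherent_def admissible_in_def v_def)
    show "s (Suc k) \<in> {1..7}" for k using s(1) by (auto simp: S_star_def)
    show "(L, v k n) \<in> sandwich_group (s (Suc k) div 2)" if "sandwiched_by L (v k) n" for k n L
      using s(2)[of k] that unfolding coherent_def Let_def v_def by blast
    show "v (Suc k) = diagram_perm (s (Suc k)) \<circ> derived (v k)" for k by (simp add: v_def)
    show "- N \<le> N" using that by simp
  qed
  have win: "\<exists>u\<in>sector_codes. \<forall>n\<in>{- N..N}. u n = v 0 n" if N: "0 \<le> N" for N
  proof -
    have "- N \<le> N" using N by simp
    moreover obtain p q x where "sector p q" "orbit p q (v 0) x (- N) N" using orb[OF N] by blast
    ultimately show ?thesis by (intro orbit_extends)
  qed
  have ex: "\<exists>u\<in>sector_codes. \<forall>n. \<bar>n\<bar> \<le> N \<longrightarrow> u n = v 0 n" if N: "0 \<le> N" for N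
  proof -
    obtain u where u: "u \<in> sector_codes" "\<forall>n\<in>{- N..N}. u n = v 0 n" using win[OF N] by blast
    have "n \<in> {- N..N}" if "\<bar>n\<bar> \<le> N" for n using that by auto
    with u show ?thesis by blast
  qed
  have "v 0 \<in> window_closure sector_codes"
  proof (rule window_closureI)
    fix N
    obtain u where u: "u \<in> sector_codes" "\<And>n. \<bar>n\<bar> \<le> \<bar>N\<bar> \<Longrightarrow> u n = v 0 n"
      using ex[of "\<bar>N\<bar>"] by auto
    have "u n = v 0 n" if "\<bar>n\<bar> \<le> N" for n using that by (intro u(2)) simp
    then show "\<exists>u\<in>sector_codes. \<forall>n. \<bar>n\<bar> \<le> N \<longrightarrow> u n = v 0 n" using u(1) by blast
  qed
  moreover have "s 0 \<le> 7" using s(1) by (simp add: S_star_def)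
  ultimately show ?thesis unfolding v_def by auto
qed

section \<open>Reduction to the first sector\<close>

lemma shadow_periodic: "shadow \<theta> (k + 8 * m) = shadow \<theta> k" "slope \<theta> (k + 8 * m) = slope \<theta> k"
proof (induction m)
  case (Suc m)
  have e: "k + 8 * Suc m = k + 8 * m + 8" by simp
  show "shadow \<theta> (k + 8 * Suc m) = shadow \<theta> k" unfolding e shadow_add_8 by (rule Suc)
  show "slope \<theta> (k + 8 * Suc m) = slope \<theta> k" unfolding e slope_add_8 by (rule Suc)
qed simp_all

definition oct_words :: "real \<Rightarrow> bi_word set" where
  "oct_words \<theta> = {side_label \<circ> \<sigma> | \<sigma> x. oct_code \<theta> \<sigma> x}"

lemma oct_words_iff: "w \<in> oct_words \<theta> \<longleftrightarrow> (\<exists>\<sigma> x. w = side_label \<circ> \<sigma> \<and> oct_code \<theta> \<sigma> x)"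
  by (simp add: oct_words_def)

lemma cutting_sequences_iff:
  "w \<in> cutting_sequences \<longleftrightarrow> (\<exists>\<theta> \<tau> T \<sigma>. w = side_label \<circ> \<sigma> \<and> octagon_trajectory \<theta> \<tau> T \<sigma>)"
  by (simp add: cutting_sequences_def)

lemma cutting_sequences_oct_words: "w \<in> cutting_sequences \<longleftrightarrow> (\<exists>\<theta>. w \<in> oct_words \<theta>)"
proof
  assume "w \<in> cutting_sequences"
  then obtain \<theta> \<tau> T \<sigma> where w: "w = side_label \<circ> \<sigma>" and t: "octagon_trajectory \<theta> \<tau> T \<sigma>"
    unfolding cutting_sequences_iff by (elim exE conjE)
  obtain x where "oct_code \<theta> \<sigma> x" using trajectory_oct_code[OF t] by (elim exE)
  with w show "\<exists>\<theta>. w \<in> oct_words \<theta>" unfolding oct_words_iff by (intro exI conjI)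
next
  assume "\<exists>\<theta>. w \<in> oct_words \<theta>"
  then obtain \<theta> \<sigma> x where w: "w = side_label \<circ> \<sigma>" and x: "oct_code \<theta> \<sigma> x"
    unfolding oct_words_iff by (elim exE conjE)
  obtain \<tau> T where "octagon_trajectory \<theta> \<tau> T \<sigma>" using oct_code_trajectory[OF x] by (elim exE)
  with w show "w \<in> cutting_sequences" unfolding cutting_sequences_iff by (intro exI conjI)
qed

text \<open>Shadows and slopes have period 8 in the side number and labels have period 4, so
  symmetries may move sides out of the range 1 to 8.\<close>

lemma oct_wordsI:
  assumes "\<And>n. 1 \<le> \<sigma> n" "\<And>n. 0 < slope \<theta> (\<sigma> n)" "\<And>n. shadow \<theta> (\<sigma> n) < x n"
    "\<And>n. x n < shadow \<theta> (\<sigma> n + 1)" "\<And>n. x (n + 1) = x n + (shadow \<theta> (\<sigma> n + 5) - shadow \<theta> (\<sigma> n))"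
  shows "side_label \<circ> \<sigma> \<in> oct_words \<theta>"
proof -
  define \<sigma>' where "\<sigma>' n = (\<sigma> n - 1) mod 8 + 1" for n
  have \<sigma>: "\<sigma> n = \<sigma>' n + 8 * ((\<sigma> n - 1) div 8)" for n
    using assms(1)[of n] mod_mult_div_eq[of "\<sigma> n - 1" 8] unfolding \<sigma>'_def by linarith
  have per: "shadow \<theta> (\<sigma> n + m) = shadow \<theta> (\<sigma>' n + m)" "slope \<theta> (\<sigma> n) = slope \<theta> (\<sigma>' n)" for n m
    using shadow_periodic(1)[of \<theta> "\<sigma>' n + m" "(\<sigma> n - 1) div 8"] shadow_periodic(2)[of \<theta> "\<sigma>' n"
        "(\<sigma> n - 1) div 8"]
      \<sigma>[of n] by (simp_all add: ac_simps)
  have per0: "shadow \<theta> (\<sigma> n) = shadow \<theta> (\<sigma>' n)" for n using per(1)[of n 0] by simp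
  have "\<sigma>' n \<in> {1..8}" for n unfolding \<sigma>'_def using mod_less_divisor[of 8 "\<sigma> n - 1"] by auto
  then have "oct_code \<theta> \<sigma>' x"
    unfolding oct_code_def using assms(2-5)[unfolded per per0] by blast
  moreover have "side_label (\<sigma>' n) = side_label (\<sigma> n)" for n
  proof -
    define d where "d = (\<sigma> n - 1) div 8"
    have "\<sigma> n = \<sigma>' n + 4 * (2 * d)" using \<sigma>[of n] unfolding d_def by linarith
    then have "\<sigma> n mod 4 = \<sigma>' n mod 4" by (simp only: mod_mult_self2)
    then show ?thesis by (simp add: side_label_def)
  qed
  then have "side_label \<circ> \<sigma> = side_label \<circ> \<sigma>'" by (simp add: fun_eq_iff)
  ultimately show ?thesis unfolding oct_words_iff by blast
qed

text \<open>The clockwise rotation by \<open>pi / 4\<close> takes side \<open>k\<close> to side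
  \<open>k + 1\<close> and preserves projections, so the positions are kept.\<close>

lemma oct_words_rotate:
  assumes "w \<in> oct_words \<theta>"
  shows "diagram_perm 2 \<circ> w \<in> oct_words (\<theta> - pi / 4)"
proof -
  obtain \<sigma> x where w: "w = side_label \<circ> \<sigma>" and x: "oct_code \<theta> \<sigma> x"
    using assms unfolding oct_words_iff by blast
  have e: "\<theta> - pi / 4 - 5 * pi / 8 + (real (k + 1) - 1) * pi / 4 =
      \<theta> - 5 * pi / 8 + (real k - 1) * pi / 4"
    "\<theta> - pi / 4 + (real (k + 1) - 1) * pi / 4 = \<theta> + (real k - 1) * pi / 4" for k
    by (simp_all add: field_simps)
  have sh: "shadow (\<theta> - pi / 4) (k + 1) = shadow \<theta> k"
      and sl: "slope (\<theta> - pi / 4) (k + 1) = slope \<theta> k" for k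
    unfolding shadow_def slope_def e by simp_all
  have lab: "side_label (k + 1) = diagram_perm 2 (side_label k)" for k
  proof -
    have "k mod 4 < 4" by simp
    then have "k mod 4 = 0 \<or> k mod 4 = 1 \<or> k mod 4 = 2 \<or> k mod 4 = 3" by linarith
    then show ?thesis unfolding side_label_def
      by (elim disjE) (simp_all add: mod_Suc diagram_perm_simps diagram_perm_Suc_0)
  qed
  have "side_label \<circ> (\<lambda>n. \<sigma> n + 1) \<in> oct_words (\<theta> - pi / 4)"
  proof (rule oct_wordsI[where x = x])
    fix n
    have c: "0 < slope \<theta> (\<sigma> n)" "shadow \<theta> (\<sigma> n) < x n" "x n < shadow \<theta> (\<sigma> n + 1)"
      "x (n + 1) = x n + (shadow \<theta> (\<sigma> n + 5) - shadow \<theta> (\<sigma> n))"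
      using x unfolding oct_code_def by blast+
    show "1 \<le> \<sigma> n + 1" by simp
    show "0 < slope (\<theta> - pi / 4) (\<sigma> n + 1)" unfolding sl by (rule c)
    show "shadow (\<theta> - pi / 4) (\<sigma> n + 1) < x n" unfolding sh by (rule c)
    show "x n < shadow (\<theta> - pi / 4) (\<sigma> n + 1 + 1)" unfolding sh by (rule c)
    have "shadow (\<theta> - pi / 4) (\<sigma> n + 1 + 5) = shadow \<theta> (\<sigma> n + 5)" using sh[of "\<sigma> n + 5"]
        by (simp add: ac_simps)
    then show "x (n + 1) = x n + (shadow (\<theta> - pi / 4) (\<sigma> n + 1 + 5) - shadow (\<theta> - pi / 4) (\<sigma> n +
        1))"
      unfolding sh using c(4) by simp
  qed
  moreover have "side_label \<circ> (\<lambda>n. \<sigma> n + 1) = diagram_perm 2 \<circ> w"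
    unfolding w using lab by (simp add: fun_eq_iff)
  ultimately show ?thesis by simp
qed

text \<open>The reflection in the line at angle \<open>pi / 8\<close> takes vertex \<open>k\<close>
  to vertex \<open>14 - k\<close>, hence side \<open>k\<close> to side \<open>13 - k\<close>, and
  reverses the sign of projections.\<close>

lemma oct_words_reflect:
  assumes "w \<in> oct_words \<theta>"
  shows "diagram_perm 1 \<circ> w \<in> oct_words (pi / 4 - \<theta>)"
proof -
  obtain \<sigma> x where w: "w = side_label \<circ> \<sigma>" and x: "oct_code \<theta> \<sigma> x"
    using assms unfolding oct_words_iff by blast
  have sh: "shadow (pi / 4 - \<theta>) (14 - k) = - shadow \<theta> k" if "k \<le> 13" for k
  proof -
    have "pi / 4 - \<theta> - 5 * pi / 8 + (real (14 - k) - 1) * pi / 4 =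
        2 * pi - (\<theta> - 5 * pi / 8 + (real k - 1) * pi / 4)"
      using that by (simp add: of_nat_diff field_simps)
    then show ?thesis unfolding shadow_def by (simp only: sin_2pi_minus)
  qed
  have lab: "side_label (13 - k) = diagram_perm 1 (side_label k)" if "k \<le> 8" for k
  proof -
    have "k = 0 \<or> k = 1 \<or> k = 2 \<or> k = 3 \<or> k = 4 \<or> k = 5 \<or> k = 6 \<or> k = 7 \<or> k = 8" using that
        by linarith
    then show ?thesis unfolding side_label_def
      by (elim disjE) (simp_all add: diagram_perm_simps diagram_perm_Suc_0)
  qed
  have r: "\<sigma> n \<in> {1..8}" for n using x unfolding oct_code_def by blast
  have "side_label \<circ> (\<lambda>n. 13 - \<sigma> n) \<in> oct_words (pi / 4 - \<theta>)"
  proof (rule oct_wordsI[where x = "\<lambda>n. - x n"])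
    fix n
    have c: "0 < slope \<theta> (\<sigma> n)" "shadow \<theta> (\<sigma> n) < x n" "x n < shadow \<theta> (\<sigma> n + 1)"
      "x (n + 1) = x n + (shadow \<theta> (\<sigma> n + 5) - shadow \<theta> (\<sigma> n))"
      using x unfolding oct_code_def by blast+
    have k: "1 \<le> \<sigma> n" "\<sigma> n \<le> 8" using r[of n] by auto
    have s1: "shadow (pi / 4 - \<theta>) (13 - \<sigma> n) = - shadow \<theta> (\<sigma> n + 1)" using sh[of "\<sigma> n + 1"] k
        by simp
    have "13 - \<sigma> n + 1 = 14 - \<sigma> n" using k by simp
    then have s2: "shadow (pi / 4 - \<theta>) (13 - \<sigma> n + 1) = - shadow \<theta> (\<sigma> n)" using sh[of "\<sigma> n"] k
        by simp
    have "13 - \<sigma> n + 5 = 14 - (\<sigma> n + 4) + 8" using k by simp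
    then have s3: "shadow (pi / 4 - \<theta>) (13 - \<sigma> n + 5) = shadow \<theta> (\<sigma> n)"
      using sh[of "\<sigma> n + 4"] shadow_add_8[of "pi / 4 - \<theta>"
          "14 - (\<sigma> n + 4)"] shadow_add_4[of \<theta> "\<sigma> n"] k by simp
    have s4: "shadow \<theta> (\<sigma> n + 5) = - shadow \<theta> (\<sigma> n + 1)"
      using shadow_add_4[of \<theta> "\<sigma> n + 1"] by (simp add: ac_simps)
    show "1 \<le> 13 - \<sigma> n" using k by simp
    show "0 < slope (pi / 4 - \<theta>) (13 - \<sigma> n)"
      using shadow_step[of "pi / 4 - \<theta>" "13 - \<sigma> n"] shadow_step[of \<theta> "\<sigma> n"] c(1)
          unfolding s1 s2 by simp
    show "shadow (pi / 4 - \<theta>) (13 - \<sigma> n) < - x n" unfolding s1 using c(3) by simp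
    show "- x n < shadow (pi / 4 - \<theta>) (13 - \<sigma> n + 1)" unfolding s2 using c(2) by simp
    show "- x (n + 1) = - x n + (shadow (pi / 4 - \<theta>) (13 - \<sigma> n +
        5) - shadow (pi / 4 - \<theta>) (13 - \<sigma> n))"
      unfolding s1 s3 c(4) s4 by simp
  qed
  moreover have "side_label \<circ> (\<lambda>n. 13 - \<sigma> n) = diagram_perm 1 \<circ> w"
    unfolding w using lab r by (auto simp: fun_eq_iff)
  ultimately show ?thesis by simp
qed

lemma oct_words_periodic: "oct_words (\<theta> + 2 * pi * of_int z) = oct_words \<theta>"
proof -
  have p: "sin (x + 2 * pi * of_int z) = sin x" for x by (simp add: sin_add)
  have e: "\<theta> + 2 * pi * of_int z - 5 * pi / 8 + (real k - 1) * pi / 4 =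
      \<theta> - 5 * pi / 8 + (real k - 1) * pi / 4 + 2 * pi * of_int z"
    "\<theta> + 2 * pi * of_int z + (real k - 1) * pi / 4 =
        \<theta> + (real k - 1) * pi / 4 + 2 * pi * of_int z" for k
    by simp_all
  have "shadow (\<theta> + 2 * pi * of_int z) = shadow \<theta>" "slope (\<theta> + 2 * pi * of_int z) = slope \<theta>"
    unfolding fun_eq_iff shadow_def slope_def e p by simp_all
  then show ?thesis unfolding oct_words_def oct_code_def by simp
qed

definition side_index :: "letter \<Rightarrow> nat" where
  "side_index L = (case L of A \<Rightarrow> 1 | B \<Rightarrow> 2 | C \<Rightarrow> 3 | D \<Rightarrow> 4)"

lemma side_label_index: "side_label (side_index L) = L"
  by (cases L) (simp_all add: side_label_def side_index_def)

lemma side_index_label: "k \<in> {1, 2, 3, 4} \<Longrightarrow> side_index (side_label k) = k"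
  by (auto simp: side_label_def side_index_def)

lemma slope_values:
  "slope \<theta> 1 = sin \<theta>" "slope \<theta> 2 = (sin \<theta> + cos \<theta>) / sqrt 2" "slope \<theta> 3 = cos \<theta>"
  "slope \<theta> 4 = (cos \<theta> - sin \<theta>) / sqrt 2"
proof -
  have "sqrt 2 * sqrt 2 = 2" by simp
  then have r: "sqrt 2 / 2 = 1 / sqrt 2" by (simp add: field_simps del: real_sqrt_mult_self)
  have "(real 2 - 1) * pi / 4 = pi / 4" "(real 3 - 1) * pi / 4 = pi / 2"
      "(real 4 - 1) * pi / 4 = pi / 4 + pi / 2"
    by simp_all
  note e = this
  show "slope \<theta> 1 = sin \<theta>" "slope \<theta> 3 = cos \<theta>" unfolding slope_def e by (simp_all add: sin_add)
  show "slope \<theta> 2 = (sin \<theta> + cos \<theta>) / sqrt 2" unfolding slope_def e sin_add sin_45 cos_45 r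
      by (simp add: field_simps)
  show "slope \<theta> 4 = (cos \<theta> - sin \<theta>) / sqrt 2"
      unfolding slope_def e sin_add cos_add sin_45 cos_45 r by (simp add: field_simps)
qed

text \<open>This identifies the abstract exchange with the projection of the octagon: sides 1 to 4
  are the intervals, and their side translations are the displacements.\<close>

lemma positions_shadow:
  assumes p: "p = slope \<theta> 1" and q: "q = slope \<theta> 4 - slope \<theta> 1"
  shows "len p q L = slope \<theta> (side_index L)"
    and "top_pos p q L = shadow \<theta> (side_index L) - shadow \<theta> 1"
    and "disp p q L = shadow \<theta> (side_index L + 5) - shadow \<theta> (side_index L)"
proof -
  have r: "sqrt 2 * ((cos \<theta> - sin \<theta>) / sqrt 2) = cos \<theta> - sin \<theta>" by simp
  have r2: "sqrt 2 * x = 2 * x / sqrt 2" for x by (simp add: field_simps)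
  have B: "len p q B = slope \<theta> 2"
    unfolding len_def letter.case p q slope_values r2[of "sin \<theta>"] by (simp add: field_simps)
  have C: "len p q C = slope \<theta> 3"
    unfolding len_def letter.case p q slope_values right_diff_distrib r by simp
  have AD: "len p q A = slope \<theta> 1" "len p q D = slope \<theta> 4" unfolding len_def letter.case p q
      by simp_all
  show l: "len p q L = slope \<theta> (side_index L)" for L
    using AD B C by (cases L) (simp_all add: side_index_def)
  have st: "slope \<theta> 1 = shadow \<theta> 2 - shadow \<theta> 1" "slope \<theta> 2 = shadow \<theta> 3 - shadow \<theta> 2"
    "slope \<theta> 3 = shadow \<theta> 4 - shadow \<theta> 3" "slope \<theta> 4 = shadow \<theta> 5 - shadow \<theta> 4"
    using shadow_step[of \<theta> 1, unfolded one_add_one] shadow_step[of \<theta> 2] shadow_step[of \<theta> 3]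
        shadow_step[of \<theta> 4] by simp_all
  have neg: "shadow \<theta> 5 = - shadow \<theta> 1" "shadow \<theta> 6 = - shadow \<theta> 2" "shadow \<theta> 7 = - shadow \<theta> 3"
    "shadow \<theta> 8 = - shadow \<theta> 4" "shadow \<theta> 9 = shadow \<theta> 1"
    using shadow_add_4[of \<theta> 1] shadow_add_4[of \<theta> 2] shadow_add_4[of \<theta> 3] shadow_add_4[of \<theta> 4]
      shadow_add_8[of \<theta> 1] by simp_all
  show "top_pos p q L = shadow \<theta> (side_index L) - shadow \<theta> 1"
    by (cases L; simp only: top_pos_def letter.case AD B C st side_index_def; simp)
  show "disp p q L = shadow \<theta> (side_index L + 5) - shadow \<theta> (side_index L)"
    by (cases L; simp only: disp_def bot_pos_def top_pos_def letter.case AD B C st side_index_def;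
      simp add: neg)
qed

lemma oct_words_sector:
  assumes "w \<in> oct_words \<theta>" "0 \<le> \<theta>" "\<theta> \<le> pi / 8"
  shows "w \<in> sector_codes"
proof -
  obtain \<sigma> x where w: "w = side_label \<circ> \<sigma>" and x: "oct_code \<theta> \<sigma> x"
    using assms(1) unfolding oct_words_iff by blast
  define p where "p = slope \<theta> 1"
  define q where "q = slope \<theta> 4 - slope \<theta> 1"
  have nonneg: "0 \<le> slope \<theta> k" if "k \<in> {1, 2, 3, 4}" for k
  proof -
    have "0 \<le> \<theta> + (real k - 1) * pi / 4" "\<theta> + (real k - 1) * pi / 4 \<le> pi"
      using that assms(2,3) by (auto simp: field_simps)
    then show ?thesis unfolding slope_def by (rule sin_ge_zero)
  qed
  \<comment> \<open>In the first sector sides 1 to 4 have nonnegative slopes, so their opposites do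
    not and cannot be exit sides.\<close>
  have \<sigma>: "\<sigma> n \<in> {1, 2, 3, 4}" for n
  proof (rule ccontr)
    assume "\<sigma> n \<notin> {1, 2, 3, 4}"
    moreover have "\<sigma> n \<in> {1..8}" "0 < slope \<theta> (\<sigma> n)" using x unfolding oct_code_def by blast+
    ultimately have "\<sigma> n = \<sigma> n - 4 + 4" "\<sigma> n - 4 \<in> {1, 2, 3, 4}" by auto
    then have "slope \<theta> (\<sigma> n) \<le> 0" using slope_add_4[of \<theta> "\<sigma> n - 4"] nonneg[of "\<sigma> n - 4"] by simp
    with \<open>0 < slope \<theta> (\<sigma> n)\<close> show False by simp
  qed
  have s4: "slope \<theta> 4 = sin (pi / 4 - \<theta>)"
  proof -
    have "\<theta> + (real 4 - 1) * pi / 4 = pi - (pi / 4 - \<theta>)" by (simp add: field_simps)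
    then show ?thesis unfolding slope_def by (simp only: sin_pi_minus)
  qed
  have "sector p q"
  proof -
    have "sin \<theta> \<le> sin (pi / 4 - \<theta>)"
      using assms(2,3) pi_gt_zero by (intro sin_monotone_2pi_le) linarith+
    moreover have "0 < sin (pi / 4 - \<theta>)" using assms(2,3) pi_gt_zero
        by (intro sin_gt_zero) linarith+
    moreover have "0 \<le> sin \<theta>" using nonneg[of 1] unfolding slope_values by simp
    ultimately show ?thesis unfolding sector_def p_def q_def s4
        by (simp add: slope_values(1)[unfolded One_nat_def])
  qed
  moreover have "code p q w (\<lambda>n. x n - shadow \<theta> 1)"
    unfolding code_def
  proof (intro allI conjI)
    fix n
    have c: "shadow \<theta> (\<sigma> n) < x n" "x n < shadow \<theta> (\<sigma> n + 1)"
      "x (n + 1) = x n + (shadow \<theta> (\<sigma> n + 5) - shadow \<theta> (\<sigma> n))"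
      using x unfolding oct_code_def by blast+
    have i: "side_index (w n) = \<sigma> n" using side_index_label[OF \<sigma>] by (simp add: w)
    show "inside p q (x n - shadow \<theta> 1) (w n)"
      unfolding inside_def positions_shadow[OF p_def q_def] i using c shadow_step[of \<theta> "\<sigma> n"]
          by simp
    show "x (n + 1) - shadow \<theta> 1 = x n - shadow \<theta> 1 + disp p q (w n)"
      unfolding positions_shadow[OF p_def q_def] i using c(3) by simp
  qed
  ultimately show ?thesis unfolding sector_codes_def by blast
qed

lemma code_scale:
  assumes "code p q u x" "0 < c"
  shows "code (c * p) (c * q) u (\<lambda>n. c * x n)"
proof -
  have l: "len (c * p) (c * q) L = c * len p q L" for L
      by (cases L) (simp_all add: len_def algebra_simps)
  have t: "top_pos (c * p) (c * q) L = c * top_pos p q L"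
      "disp (c * p) (c * q) L = c * disp p q L" for L
    by (cases L; simp add: top_pos_def bot_pos_def disp_def l algebra_simps)+
  show ?thesis
    unfolding code_def
  proof (intro allI conjI)
    fix n
    have x: "top_pos p q (u n) < x n" "x n < top_pos p q (u n) + len p q (u n)"
      "x (n + 1) = x n + disp p q (u n)"
      using assms(1) unfolding code_def inside_def by blast+
    show "inside (c * p) (c * q) (c * x n) (u n)"
      unfolding inside_def l t distrib_left[symmetric] using x(1,2) assms(2) by simp
    show "c * x (n + 1) = c * x n + disp (c * p) (c * q) (u n)"
      unfolding t x(3) by (rule distrib_left)
  qed
qed

lemma sector_codes_oct_words:
  assumes "w \<in> sector_codes"
  shows "\<exists>\<theta>. w \<in> oct_words \<theta>"
proof -
  obtain p q x where pq: "sector p q" and x: "code p q w x" using assms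
      by (auto simp: sector_codes_def)
  \<comment> \<open>If \<open>p\<close> is proportional to the sine, then
    \<open>slope \<theta> 4 = (cos \<theta> - sin \<theta>) / sqrt 2\<close> must be proportional to
    \<open>p + q\<close>, which forces this value for the cosine; \<open>\<rho>\<close> normalizes
    the pair.\<close>
  define c where "c = p + sqrt 2 * (p + q)"
  define \<rho> where "\<rho> = sqrt (c\<^sup>2 + p\<^sup>2)"
  have c: "0 < c" using pq unfolding c_def sector_def by (simp add: add_nonneg_pos)
  then have \<rho>: "0 < \<rho>" unfolding \<rho>_def by (simp add: sum_power2_gt_zero_iff)
  have "(c / \<rho>)\<^sup>2 + (p / \<rho>)\<^sup>2 = 1"
  proof -
    have "c\<^sup>2 + p\<^sup>2 = \<rho>\<^sup>2" unfolding \<rho>_def by simp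
    then show ?thesis unfolding power_divide add_divide_distrib[symmetric] using \<rho> by simp
  qed
  then obtain \<theta> where \<theta>: "c / \<rho> = cos \<theta>" "p / \<rho> = sin \<theta>" using sincos_total_2pi by blast
  define p' where "p' = 1 / \<rho> * p"
  define q' where "q' = 1 / \<rho> * q"
  have p': "p' = slope \<theta> 1" unfolding p'_def slope_values \<theta>(2)[symmetric] by simp
  have "slope \<theta> 4 = (c / \<rho> - p / \<rho>) / sqrt 2" unfolding slope_values \<theta> ..
  also have "\<dots> = (p + q) / \<rho>" using \<rho> by (simp add: c_def field_simps)
  finally have q': "q' = slope \<theta> 4 - slope \<theta> 1" unfolding q'_def p'[symmetric] p'_def using \<rho>
      by (simp add: field_simps)
  define y where "y n = 1 / \<rho> * x n" for n
  have "y = (\<lambda>n. 1 / \<rho> * x n)" by (simp add: y_def fun_eq_iff)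
  then have y: "code p' q' w y" unfolding p'_def q'_def using code_scale[OF x, of "1 / \<rho>"] \<rho>
      by (simp only:) simp
  note pos = positions_shadow[OF p' q']
  have "side_label \<circ> (\<lambda>n. side_index (w n)) \<in> oct_words \<theta>"
  proof (rule oct_wordsI[where x = "\<lambda>n. y n + shadow \<theta> 1"])
    fix n
    have i: "inside p' q' (y n) (w n)" "y (n + 1) = y n + disp p' q' (w n)" using y
        by (auto simp: code_def)
    then have ii: "shadow \<theta> (side_index (w n)) - shadow \<theta> 1 < y n"
      "y n < shadow \<theta> (side_index (w n)) - shadow \<theta> 1 + slope \<theta> (side_index (w n))"
      unfolding inside_def pos by simp_all
    show "1 \<le> side_index (w n)" by (cases "w n") (simp_all add: side_index_def)
    show "0 < slope \<theta> (side_index (w n))" using ii by simp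
    show "shadow \<theta> (side_index (w n)) < y n + shadow \<theta> 1" using ii by simp
    show "y n + shadow \<theta> 1 < shadow \<theta> (side_index (w n) + 1)"
      using ii shadow_step[of \<theta> "side_index (w n)"] by simp
    show "y (n + 1) + shadow \<theta> 1 =
        y n + shadow \<theta> 1 + (shadow \<theta> (side_index (w n) + 5) - shadow \<theta> (side_index (w n)))"
      unfolding i(2) pos by simp
  qed
  then show ?thesis by (intro exI[of _ \<theta>]) (simp add: comp_def side_label_index)
qed

text \<open>Rotations by \<open>pi / 4\<close> bring the angle into \<open>[0, pi / 4]\<close>, and
  a reflection, if needed, brings it into \<open>[0, pi / 8]\<close>.\<close>

lemma oct_words_diagram:
  assumes "w \<in> oct_words \<theta>"
  shows "\<exists>i\<le>7. diagram_perm i \<circ> w \<in> sector_codes"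
proof -
  have rot: "\<exists>l\<le>7. diagram_perm l \<circ> w \<in> oct_words (\<theta> - real m * (pi / 4))" for m
  proof (induction m)
    case 0
    show ?case using assms by (intro exI[of _ 0]) (simp add: diagram_perm_simps)
  next
    case (Suc m)
    then obtain l where l: "l \<le> 7" "diagram_perm l \<circ> w \<in> oct_words (\<theta> - real m * (pi / 4))" by blast
    obtain l' where l': "l' \<le> 7" "diagram_perm 2 \<circ> diagram_perm l = diagram_perm l'"
      using diagram_perm_comp[of 2 l] l(1) by auto
    have "\<theta> - real m * (pi / 4) - pi / 4 = \<theta> - real (Suc m) * (pi / 4)" by (simp add: field_simps)
    then have "diagram_perm l' \<circ> w \<in> oct_words (\<theta> - real (Suc m) * (pi / 4))"
      using oct_words_rotate[OF l(2)] by (simp only: l'(2)[symmetric] comp_assoc)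
    then show ?case using l'(1) by blast
  qed
  define f where "f = \<lfloor>\<theta> / (pi / 4)\<rfloor>"
  define \<theta>' where "\<theta>' = \<theta> - of_int f * (pi / 4)"
  have "of_int f \<le> \<theta> / (pi / 4)" "\<theta> / (pi / 4) < of_int f + 1" unfolding f_def by linarith+
  then have \<theta>': "0 \<le> \<theta>'" "\<theta>' \<le> pi / 4" unfolding \<theta>'_def by (simp_all add: field_simps)
  \<comment> \<open>The number of rotations is reduced modulo 8 to a natural number; the rest
    consists of full turns.\<close>
  have "8 * (f div 8) + f mod 8 = f" "int (nat (f mod 8)) = f mod 8" by (rule mult_div_mod_eq) simp
  then have "f = int (nat (f mod 8)) + 8 * (f div 8)" by linarith
  then have "real_of_int f = real_of_int (int (nat (f mod 8)) + 8 * (f div 8))" by (rule arg_cong)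
  then have "real_of_int f = real (nat (f mod 8)) + 8 * of_int (f div 8)"
    by (simp only: of_int_add of_int_mult of_int_of_nat_eq of_int_numeral)
  then have eq: "\<theta> - real (nat (f mod 8)) * (pi / 4) = \<theta>' + 2 * pi * of_int (f div 8)"
    unfolding \<theta>'_def by (simp add: field_simps)
  then obtain l where l: "l \<le> 7" "diagram_perm l \<circ> w \<in> oct_words \<theta>'"
    using rot[of "nat (f mod 8)"] unfolding eq oct_words_periodic by blast
  show ?thesis
  proof (cases "\<theta>' \<le> pi / 8")
    case True
    then show ?thesis using oct_words_sector[OF l(2) \<theta>'(1)] l(1) by blast
  next
    case False
    obtain l' where l': "l' \<le> 7" "diagram_perm 1 \<circ> diagram_perm l = diagram_perm l'"
      using diagram_perm_comp[of 1 l] l(1) by auto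
    have "diagram_perm l' \<circ> w \<in> oct_words (pi / 4 - \<theta>')"
      using oct_words_reflect[OF l(2)] by (simp only: l'(2)[symmetric] comp_assoc)
    then have "diagram_perm l' \<circ> w \<in> sector_codes"
      using \<theta>' False by (intro oct_words_sector) auto
    then show ?thesis using l'(1) by blast
  qed
qed

lemma diagram_perm_generated:
  "diagram_perm 3 = diagram_perm 1 \<circ> diagram_perm 2"
      "diagram_perm 4 = diagram_perm 2 \<circ> diagram_perm 2"
  "diagram_perm 5 = diagram_perm 1 \<circ> diagram_perm 4"
      "diagram_perm 6 = diagram_perm 2 \<circ> diagram_perm 4"
  "diagram_perm 7 = diagram_perm 1 \<circ> diagram_perm 6"
proof -
  have ext: "f = g" if "f A = g A" "f B = g B" "f C = g C" "f D = g D" for f g :: "letter \<Rightarrow> letter"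
    by (rule ext, case_tac x) (simp_all add: that)
  show "diagram_perm 3 = diagram_perm 1 \<circ> diagram_perm 2"
      "diagram_perm 4 = diagram_perm 2 \<circ> diagram_perm 2"
    "diagram_perm 5 = diagram_perm 1 \<circ> diagram_perm 4"
        "diagram_perm 6 = diagram_perm 2 \<circ> diagram_perm 4"
    "diagram_perm 7 = diagram_perm 1 \<circ> diagram_perm 6"
    by (rule ext; simp only: diagram_perm_simps comp_apply)+
qed

text \<open>Permutations 2 and 6 are inverse quarter turns, and all the others are
  involutions.\<close>

lemma diagram_perm_inverse:
  assumes "i \<le> 7"
  shows "\<exists>l\<le>7. diagram_perm l \<circ> diagram_perm i = id"
proof -
  have ext: "f = id" if "f A = A" "f B = B" "f C = C" "f D = D" for f :: "letter \<Rightarrow> letter"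
    by (rule ext, case_tac x) (simp_all add: that)
  have "diagram_perm (if i = 2 then 6 else if i = 6 then 2 else i) \<circ> diagram_perm i = id"
    by (cases rule: diagram_index_cases[OF assms]; hypsubst; rule ext;
        simp add: diagram_perm_simps diagram_perm_Suc_0)
  moreover have "(if i = 2 then 6 else if i = 6 then 2 else i) \<le> 7" using assms by auto
  ultimately show ?thesis by blast
qed

lemma cutting_sequences_recode:
  assumes "w \<in> cutting_sequences" "i \<le> 7"
  shows "diagram_perm i \<circ> w \<in> cutting_sequences"
proof -
  have 1: "diagram_perm 1 \<circ> v \<in> cutting_sequences" and 2: "diagram_perm 2 \<circ> v \<in> cutting_sequences"
    if "v \<in> cutting_sequences" for v
    using that oct_words_rotate oct_words_reflect unfolding cutting_sequences_oct_words by blast+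
  show ?thesis
    using assms(1) 1 2
    by (cases rule: diagram_index_cases[OF assms(2)]; hypsubst;
      simp only: diagram_perm_generated comp_assoc diagram_perm_simps(1) id_comp)
qed

lemma cutting_sequences_diagrams:
  "cutting_sequences = (\<Union>i\<in>{0..7}. {w. diagram_perm i \<circ> w \<in> sector_codes})"
proof (intro set_eqI iffI)
  fix w assume "w \<in> cutting_sequences"
  then show "w \<in> (\<Union>i\<in>{0..7}. {w. diagram_perm i \<circ> w \<in> sector_codes})"
    using oct_words_diagram unfolding cutting_sequences_oct_words by fastforce
next
  fix w assume "w \<in> (\<Union>i\<in>{0..7}. {w. diagram_perm i \<circ> w \<in> sector_codes})"
  then obtain i where i: "i \<le> 7" "diagram_perm i \<circ> w \<in> sector_codes" by auto
  then have "diagram_perm i \<circ> w \<in> cutting_sequences"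
    using sector_codes_oct_words unfolding cutting_sequences_oct_words by blast
  moreover obtain l where "l \<le> 7" "diagram_perm l \<circ> diagram_perm i = id"
      using diagram_perm_inverse[OF i(1)] by blast
  ultimately show "w \<in> cutting_sequences"
    using cutting_sequences_recode[of "diagram_perm i \<circ> w" l] by (simp flip: comp_assoc)
qed

theorem theorem2p4p8:
  "product_topology (\<lambda>_. discrete_topology UNIV) UNIV closure_of cutting_sequences
     = {w. infinitely_coherent w}"
proof -
  \<comment> \<open>Cutting sequences are a finite union of recodings of the first sector, and
    closure commutes with both operations.\<close>
  have "window_closure cutting_sequences =
      (\<Union>i\<in>{0..7}. {w. diagram_perm i \<circ> w \<in> window_closure sector_codes})"
    unfolding cutting_sequences_diagrams window_closure_UN[OF finite_atLeastAtMost]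
    using window_closure_recode[OF bij_diagram_perm] by simp
  also have "\<dots> = {w. infinitely_coherent w}"
    using closure_infinitely_coherent infinitely_coherent_closure by fastforce
  finally show ?thesis unfolding closure_of_words .
qed

end
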